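(* Let $m\in\mathbb{N}$. For $n\in\mathbb{N}$ let $\Delta_n$ be the (rescaled) combinatorial Laplacian on the discrete torus $\mathbb{T}^m_n=(\mathbb{Z}/n\mathbb{Z})^m$, and let $\Delta$ be the Laplace–Beltrami operator on $\mathbb{T}^m=(\mathbb{S}^1)^m$, where $\mathbb{S}^1\subset\mathbb{R}^2$ is the circle of radius $1$. Then the resolvent traces $\mathrm{Tr}(\Delta_n+z^2)^{-m}$ and $\mathrm{Tr}(\Delta+z^2)^{-m}$ are smooth in $z\in\mathbb{R}_+=(0,\infty)$, and for every $k\in\mathbb{N}_0$ and $z\in\mathbb{R}_+$ $$\lim_{n\to\infty}\partial_z^{(k)}\,\mathrm{Tr}(\Delta_n+z^2)^{-m}=\partial_z^{(k)}\,\mathrm{Tr}(\Delta+z^2)^{-m}.$$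
   Context: Combinatorial Laplacian: for $f:\mathbb{Z}/n\mathbb{Z}\to\mathbb{R}$ put $(\mathscr{L}_nf)([k])=\frac{n^2}{4\pi^2}\big((f([k])-f([k-1]))+(f([k])-f([k+1]))\big)$; $\Delta_n$ is the sum over the $m$ factors of $\mathbb{T}^m_n=(\mathbb{Z}/n\mathbb{Z})^m$ of the operators $\mathscr{L}_n$ acting in the respective factor. Its spectrum, with multiplicities, is the multiset $\{\frac{n^2}{\pi^2}\sum_{i=1}^m\sin^2(\frac{\pi k_i}{n}) : k_i\in\{0,\dots,n-1\}\}$. The operator $\Delta$ is the non-negative Laplacian, and $\partial_z^{(k)}$ is the $k$-th derivative in $z$. *)

theory Defs
  imports "HOL-Analysis.Analysis"
begin

section \<open>The real Hilbert space of square-integrable functions\<close>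

text \<open>
  Elements of the space are represented by functions; equality in it is equality almost
  everywhere with respect to M. Values outside \<^term>\<open>space M\<close> are irrelevant.
\<close>

definition L2_space :: "'a measure \<Rightarrow> ('a \<Rightarrow> real) set" where
  "L2_space M = {f \<in> borel_measurable M. integrable M (\<lambda>x. (f x)\<^sup>2)}"

definition L2_inner :: "'a measure \<Rightarrow> ('a \<Rightarrow> real) \<Rightarrow> ('a \<Rightarrow> real) \<Rightarrow> real" where
  "L2_inner M f g = (LINT x|M. f x * g x)"

definition L2_orthonormal_basis :: "'a measure \<Rightarrow> ('a \<Rightarrow> real) set \<Rightarrow> bool" where
  "L2_orthonormal_basis M B \<longleftrightarrow>
     B \<subseteq> L2_space M \<and>
     (\<forall>e\<in>B. \<forall>e'\<in>B. L2_inner M e e' = (if e = e' then 1 else 0)) \<and>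
     (\<forall>f\<in>L2_space M. (\<forall>e\<in>B. L2_inner M f e = 0) \<longrightarrow> (AE x in M. f x = 0))"

text \<open>
  The Hilbert space trace. For a symmetric operator A, convergence of the diagonal sums
  in every orthonormal basis is equivalent to A being trace class.
\<close>

definition has_L2_trace ::
  "'a measure \<Rightarrow> (('a \<Rightarrow> real) \<Rightarrow> ('a \<Rightarrow> real)) \<Rightarrow> real \<Rightarrow> bool" where
  "has_L2_trace M A t \<longleftrightarrow>
     (\<forall>B. L2_orthonormal_basis M B \<longrightarrow> ((\<lambda>e. L2_inner M (A e) e) has_sum t) B)"

definition L2_trace :: "'a measure \<Rightarrow> (('a \<Rightarrow> real) \<Rightarrow> ('a \<Rightarrow> real)) \<Rightarrow> real" where
  "L2_trace M A = (THE t. has_L2_trace M A t)"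

text \<open>
  A possibly unbounded operator is given by its graph T, the set of pairs (u, T u) with u in
  the domain. The resolvent \<open>(T + c)\<^sup>-\<^sup>1\<close> sends f to the solution u of
  \<open>T u + c u = f\<close>; the choice operator only picks a representative of u modulo null sets.
\<close>

definition resolvent ::
  "'a measure \<Rightarrow> (('a \<Rightarrow> real) \<times> ('a \<Rightarrow> real)) set \<Rightarrow> real \<Rightarrow> ('a \<Rightarrow> real) \<Rightarrow> ('a \<Rightarrow> real)" where
  "resolvent M T c f =
     (SOME u. u \<in> L2_space M \<and> (\<exists>g. (u, g) \<in> T \<and> (AE x in M. g x + c * u x = f x)))"


section \<open>The discrete torus and the combinatorial Laplacian\<close>

text \<open>\<open>\<int>/n\<int>\<close> is represented by the residues \<open>0, \<dots>, n - 1\<close>, for \<open>n \<ge> 1\<close>.\<close>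

definition discrete_torus :: "nat \<Rightarrow> (int ^ 'm::finite) set" where
  "discrete_torus n = {v. \<forall>i. v $ i \<in> {0..<int n}}"

definition cycle_laplacian :: "nat \<Rightarrow> (int \<Rightarrow> real) \<Rightarrow> int \<Rightarrow> real" where
  "cycle_laplacian n h k =
     (real n)\<^sup>2 / (4 * pi\<^sup>2) *
       ((h k - h ((k - 1) mod int n)) + (h k - h ((k + 1) mod int n)))"

definition combinatorial_laplacian ::
  "nat \<Rightarrow> (int ^ 'm::finite \<Rightarrow> real) \<Rightarrow> int ^ 'm \<Rightarrow> real" where
  "combinatorial_laplacian n f v =
     (\<Sum>i\<in>UNIV. cycle_laplacian n (\<lambda>k. f (\<chi> j. if j = i then k else v $ j)) (v $ i))"

definition discrete_resolvent_power ::
  "nat \<Rightarrow> real \<Rightarrow> (int ^ 'm::finite \<Rightarrow> real) \<Rightarrow> (int ^ 'm \<Rightarrow> real)" where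
  "discrete_resolvent_power n z =
     resolvent (count_space (discrete_torus n))
       {(f, g). g = combinatorial_laplacian n f} (z\<^sup>2) ^^ CARD('m)"

definition discrete_resolvent_trace :: "'m::finite itself \<Rightarrow> nat \<Rightarrow> real \<Rightarrow> real" where
  "discrete_resolvent_trace _ n z =
     L2_trace (count_space (discrete_torus n :: (int ^ 'm) set)) (discrete_resolvent_power n z)"


section \<open>The torus and its Laplace--Beltrami operator\<close>

text \<open>The unit circle is taken in \<^typ>\<open>complex\<close>, as a copy of the Euclidean plane.\<close>

definition torus :: "(complex ^ 'm::finite) set" where
  "torus = {p. \<forall>i. p $ i \<in> sphere 0 1}"

definition torus_param :: "real ^ 'm::finite \<Rightarrow> complex ^ 'm" where
  "torus_param \<theta> = (\<chi> i. cis (\<theta> $ i))"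

text \<open>
  The map \<^term>\<open>torus_param\<close> is a local isometry from Euclidean space onto the torus, so the
  Riemannian volume is the image of Lebesgue measure on a fundamental cube, and in the angular
  coordinates the Laplace--Beltrami operator is minus the sum of the second partial derivatives.
\<close>

definition torus_measure :: "(complex ^ 'm::finite) measure" where
  "torus_measure =
     distr (restrict_space lborel (cbox 0 (\<chi> i. 2 * pi))) (restrict_space borel torus) torus_param"

definition partial_deriv :: "'m::finite \<Rightarrow> (real ^ 'm \<Rightarrow> real) \<Rightarrow> real ^ 'm \<Rightarrow> real" where
  "partial_deriv i F x = deriv (\<lambda>t. F (x + t *\<^sub>R axis i 1)) 0"

text \<open>All iterated partial derivatives exist, are differentiable and hence continuous.\<close>

definition smooth_on_torus :: "(complex ^ 'm::finite \<Rightarrow> real) \<Rightarrow> bool" where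
  "smooth_on_torus \<phi> \<longleftrightarrow>
     (\<forall>is. fold partial_deriv is (\<phi> \<circ> torus_param) differentiable_on UNIV)"

definition smooth_laplacian ::
  "(complex ^ 'm::finite \<Rightarrow> real) \<Rightarrow> complex ^ 'm \<Rightarrow> real" where
  "smooth_laplacian \<phi> p =
     - (\<Sum>i\<in>UNIV. partial_deriv i (partial_deriv i (\<phi> \<circ> torus_param)) (\<chi> j. Arg (p $ j)))"

text \<open>
  The Laplace--Beltrami operator as a self-adjoint operator in the Hilbert space: its domain
  consists of the u whose distributional Laplacian g is again square-integrable. This is the
  adjoint of \<^term>\<open>smooth_laplacian\<close> on smooth functions, which on a compact manifold
  coincides with its closure.
\<close>

definition laplace_beltrami ::
  "((complex ^ 'm::finite \<Rightarrow> real) \<times> (complex ^ 'm \<Rightarrow> real)) set" where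
  "laplace_beltrami =
     {(u, g). u \<in> L2_space torus_measure \<and> g \<in> L2_space torus_measure \<and>
        (\<forall>\<phi>. smooth_on_torus \<phi> \<longrightarrow>
           L2_inner torus_measure u (smooth_laplacian \<phi>) = L2_inner torus_measure g \<phi>)}"

definition torus_resolvent_power ::
  "real \<Rightarrow> (complex ^ 'm::finite \<Rightarrow> real) \<Rightarrow> (complex ^ 'm \<Rightarrow> real)" where
  "torus_resolvent_power z = resolvent torus_measure laplace_beltrami (z\<^sup>2) ^^ CARD('m)"

definition torus_resolvent_trace :: "'m::finite itself \<Rightarrow> real \<Rightarrow> real" where
  "torus_resolvent_trace _ z =
     L2_trace (torus_measure :: (complex ^ 'm) measure) (torus_resolvent_power z)"


section \<open>Smooth functions of one real variable\<close>

text \<open>To be used for open S only.\<close>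

definition smooth_on_open :: "real set \<Rightarrow> (real \<Rightarrow> real) \<Rightarrow> bool" where
  "smooth_on_open S h \<longleftrightarrow> (\<forall>k. (deriv ^^ k) h differentiable_on S)"

end

theory Submission
  imports Defs
begin

text \<open>
  The functions \<open>cas (k \<bullet> \<theta>)\<close> with \<open>cas t = cos t + sin t\<close> and integer frequency vectors k are a
  real orthogonal basis of eigenfunctions, both on the torus and (at \<open>\<theta> = 2 \<pi> v / n\<close>) on the discrete
  torus. By Parseval's identity the trace of a diagonal operator is the sum of its eigenvalues in
  every orthonormal basis, so both traces become sums over lattice points of \<open>(\<lambda> k + z\<^sup>2) ^ - m\<close>.
  With representatives \<open>\<bar>k i\<bar> \<le> n / 2\<close>, the bound \<open>sin x \<ge> x / 2\<close> on \<open>[0, \<pi> / 2]\<close> gives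
  \<open>\<lambda> k \<ge> \<bar>k\<bar>\<^sup>2 / 4\<close> for the discrete eigenvalues, and
  \<open>(\<Sum>i. x i) ^ m \<ge> (\<Prod>i. x i)\<close> bounds every term by the product of the m convergent
  one-dimensional series of \<open>1 / (k\<^sup>2 / 4 + z\<^sup>2 / m)\<close>, uniformly in n. Differentiation in
  \<open>w = z\<^sup>2\<close> only raises the exponent m, so dominated convergence applies to all derivatives.
\<close>

section \<open>Square-integrable functions\<close>

text \<open>With cas, all integer vectors serve as indices: cas (k x) and cas (- k x) span the same
  space as the cosine and the sine. Two features of the definitions shape the argument. The trace is
  required in every orthonormal basis, so a computation in the eigenbasis alone is not enough; and
  the resolvent is a choice among solutions, controlled only through its coefficients. Hence both
  operators are described purely by coefficients, in the locale \<open>diagonal_operator\<close>,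
  and completeness of the space enters through the Riesz-Fischer theorem, which supplies the
  solution. For the weakly defined Laplace-Beltrami operator this description requires integration
  by parts against the modes. The residues 0, ..., n - 1 admit no uniform quadratic lower bound: in
  one dimension the frequency n - 1 has an eigenvalue near 1. Centring the residues restores the
  bound, and extension by zero puts all sums on one lattice, where a single majorant
  applies.\<close>

lemma L2_spaceD:
  assumes "f \<in> L2_space M"
  shows "f \<in> borel_measurable M" "integrable M (\<lambda>x. (f x)\<^sup>2)"
  using assms by (auto simp: L2_space_def)

lemma L2_mult_integrable:
  assumes "f \<in> L2_space M" "g \<in> L2_space M"
  shows "integrable M (\<lambda>x. f x * g x)"
proof (rule Bochner_Integration.integrable_bound)
  show "integrable M (\<lambda>x. (f x)\<^sup>2 + (g x)\<^sup>2)"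
    using assms by (intro Bochner_Integration.integrable_add L2_spaceD)
  show "(\<lambda>x. f x * g x) \<in> borel_measurable M"
    using assms by (intro borel_measurable_times L2_spaceD)
  have "norm (a * b) \<le> norm (a\<^sup>2 + b\<^sup>2)" for a b :: real
  proof -
    have "2 * (\<bar>a\<bar> * \<bar>b\<bar>) \<le> a\<^sup>2 + b\<^sup>2"
      using sum_squares_bound[of "\<bar>a\<bar>" "\<bar>b\<bar>"] by simp
    moreover have "0 \<le> \<bar>a\<bar> * \<bar>b\<bar>" by simp
    ultimately have "\<bar>a\<bar> * \<bar>b\<bar> \<le> a\<^sup>2 + b\<^sup>2" by linarith
    then show ?thesis by (simp add: abs_mult)
  qed
  then show "AE x in M. norm (f x * g x) \<le> norm ((f x)\<^sup>2 + (g x)\<^sup>2)" by simp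
qed

lemma L2_add:
  assumes "f \<in> L2_space M" "g \<in> L2_space M"
  shows "(\<lambda>x. f x + g x) \<in> L2_space M"
proof -
  have "integrable M (\<lambda>x. ((f x)\<^sup>2 + (g x)\<^sup>2) + 2 * (f x * g x))"
    using assms by (intro Bochner_Integration.integrable_add integrable_mult_right L2_spaceD
      L2_mult_integrable) auto
  moreover have "((f x)\<^sup>2 + (g x)\<^sup>2) + 2 * (f x * g x) = (f x + g x)\<^sup>2" for x
    by (simp add: power2_sum)
  ultimately show ?thesis using assms by (auto simp: L2_space_def)
qed

lemma L2_scale:
  assumes "f \<in> L2_space M"
  shows "(\<lambda>x. c * f x) \<in> L2_space M"
  using assms by (auto simp: L2_space_def power_mult_distrib)

lemma L2_diff:
  assumes "f \<in> L2_space M" "g \<in> L2_space M"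
  shows "(\<lambda>x. f x - g x) \<in> L2_space M"
  using L2_add[OF assms(1) L2_scale[OF assms(2), of "-1"]] by simp

lemma L2_zero: "(\<lambda>x. 0) \<in> L2_space M"
  by (simp add: L2_space_def)

lemma L2_sum:
  assumes "\<And>i. i \<in> F \<Longrightarrow> f i \<in> L2_space M"
  shows "(\<lambda>x. \<Sum>i\<in>F. f i x) \<in> L2_space M"
  using assms by (induction F rule: infinite_finite_induct) (auto intro!: L2_add L2_zero)

lemma L2_inner_commute: "L2_inner M f g = L2_inner M g f"
  by (simp add: L2_inner_def mult.commute)

lemma L2_inner_add_left:
  assumes "f \<in> L2_space M" "g \<in> L2_space M" "h \<in> L2_space M"
  shows "L2_inner M (\<lambda>x. f x + g x) h = L2_inner M f h + L2_inner M g h"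
  using assms by (simp add: L2_inner_def distrib_right L2_mult_integrable)

lemma L2_inner_diff_left:
  assumes "f \<in> L2_space M" "g \<in> L2_space M" "h \<in> L2_space M"
  shows "L2_inner M (\<lambda>x. f x - g x) h = L2_inner M f h - L2_inner M g h"
  using assms by (simp add: L2_inner_def left_diff_distrib L2_mult_integrable)

lemma L2_inner_diff_right:
  assumes "f \<in> L2_space M" "g \<in> L2_space M" "h \<in> L2_space M"
  shows "L2_inner M h (\<lambda>x. f x - g x) = L2_inner M h f - L2_inner M h g"
  using L2_inner_diff_left[OF assms] by (simp add: L2_inner_commute)

lemma L2_inner_scale_left:
  "L2_inner M (\<lambda>x. c * f x) h = c * L2_inner M f h"
  by (simp add: L2_inner_def mult.assoc)

lemma L2_inner_scale_right:
  "L2_inner M h (\<lambda>x. c * f x) = c * L2_inner M h f"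
  by (simp add: L2_inner_commute[of M h] L2_inner_scale_left)

lemma L2_inner_sum_left:
  assumes "\<And>i. i \<in> F \<Longrightarrow> f i \<in> L2_space M" "h \<in> L2_space M"
  shows "L2_inner M (\<lambda>x. \<Sum>i\<in>F. a i * f i x) h = (\<Sum>i\<in>F. a i * L2_inner M (f i) h)"
proof -
  have "L2_inner M (\<lambda>x. \<Sum>i\<in>F. a i * f i x) h = (LINT x|M. (\<Sum>i\<in>F. a i * (f i x * h x)))"
    by (simp add: L2_inner_def sum_distrib_right mult.assoc)
  also have "\<dots> = (\<Sum>i\<in>F. LINT x|M. a i * (f i x * h x))"
    using assms by (intro Bochner_Integration.integral_sum integrable_mult_right L2_mult_integrable)
  finally show ?thesis by (simp add: L2_inner_def)
qed

lemma L2_inner_self_nonneg: "0 \<le> L2_inner M f f"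
  by (simp add: L2_inner_def)

lemma L2_inner_cong_AE:
  assumes "f \<in> L2_space M" "f' \<in> L2_space M" "h \<in> L2_space M" "AE x in M. f x = f' x"
  shows "L2_inner M f h = L2_inner M f' h"
  unfolding L2_inner_def
proof (rule integral_cong_AE)
  show "(\<lambda>x. f x * h x) \<in> borel_measurable M" "(\<lambda>x. f' x * h x) \<in> borel_measurable M"
    using assms by (auto simp: L2_space_def)
  show "AE x in M. f x * h x = f' x * h x"
    using assms(4) by eventually_elim simp
qed

lemma L2_inner_polarise:
  assumes "f \<in> L2_space M" "g \<in> L2_space M"
  shows "4 * L2_inner M f g =
    L2_inner M (\<lambda>x. f x + g x) (\<lambda>x. f x + g x) - L2_inner M (\<lambda>x. f x - g x) (\<lambda>x. f x - g x)"
proof -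
  have "L2_inner M (\<lambda>x. f x + g x) (\<lambda>x. f x + g x) - L2_inner M (\<lambda>x. f x - g x) (\<lambda>x. f x - g x)
      = (LINT x|M. (f x + g x) * (f x + g x) - (f x - g x) * (f x - g x))"
    unfolding L2_inner_def using assms
    by (intro Bochner_Integration.integral_diff[symmetric] L2_mult_integrable L2_add L2_diff)
  also have "\<dots> = (LINT x|M. 4 * (f x * g x))"
    by (rule Bochner_Integration.integral_cong) (auto simp: algebra_simps)
  finally show ?thesis by (simp add: L2_inner_def)
qed

lemma nn_integral_L2:
  assumes "f \<in> L2_space M"
  shows "(\<integral>\<^sup>+x. ennreal ((f x)\<^sup>2) \<partial>M) = ennreal (L2_inner M f f)"
  using nn_integral_eq_integral[OF L2_spaceD(2)[OF assms]]
  by (simp add: L2_inner_def power2_eq_square)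

lemma quarter_power: "(1/4) ^ n = ((1/2::real) ^ n)\<^sup>2"
  by (simp add: power2_eq_square flip: power_mult_distrib)

text \<open>The weights \<open>2\<^sup>n\<close> give almost everywhere absolute convergence of the telescoping series
  without Minkowski's inequality, through \<open>\<bar>a\<bar> \<le> 2\<^sup>n a\<^sup>2 + 2\<^sup>-\<^sup>n\<close>.\<close>

lemma L2_complete:
  fixes s :: "nat \<Rightarrow> 'a \<Rightarrow> real"
  assumes s: "\<And>n. s n \<in> L2_space M"
    and cauchy: "\<And>n m. n \<le> m \<Longrightarrow>
      L2_inner M (\<lambda>x. s m x - s n x) (\<lambda>x. s m x - s n x) \<le> (1/4) ^ n"
  obtains g where "g \<in> L2_space M"
    "\<And>n. L2_inner M (\<lambda>x. g x - s n x) (\<lambda>x. g x - s n x) \<le> (1/4) ^ n"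
proof -
  have meas[measurable]: "s n \<in> borel_measurable M" for n
    using s by (rule L2_spaceD)
  define d where "d n x = 2 ^ n * (s (Suc n) x - s n x)\<^sup>2" for n x
  have d_meas[measurable]: "d n \<in> borel_measurable M" for n
    unfolding d_def by measurable
  have d_nonneg: "0 \<le> d n x" for n x by (simp add: d_def)
  have d_int: "(\<integral>\<^sup>+x. ennreal (d n x) \<partial>M) \<le> ennreal ((1/2) ^ n)" for n
  proof -
    have "(\<integral>\<^sup>+x. ennreal (d n x) \<partial>M) = (\<integral>\<^sup>+x. ennreal (2 ^ n) * ennreal ((s (Suc n) x - s n x)\<^sup>2) \<partial>M)"
      unfolding d_def by (simp add: ennreal_mult)
    also have "\<dots> = ennreal (2 ^ n) * (\<integral>\<^sup>+x. ennreal ((s (Suc n) x - s n x)\<^sup>2) \<partial>M)"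
      by (rule nn_integral_cmult) measurable
    also have "\<dots> = ennreal (2 ^ n *
        L2_inner M (\<lambda>x. s (Suc n) x - s n x) (\<lambda>x. s (Suc n) x - s n x))"
      by (simp add: nn_integral_L2[OF L2_diff[OF s s]] ennreal_mult L2_inner_self_nonneg)
    also have "\<dots> \<le> ennreal (2 ^ n * (1/4) ^ n)"
      using cauchy[of n "Suc n"] by (intro ennreal_leI mult_left_mono) auto
    also have "2 ^ n * (1/4) ^ n = ((1/2) ^ n :: real)"
      by (simp add: power_mult_distrib[symmetric])
    finally show ?thesis .
  qed
  have "(\<integral>\<^sup>+x. (\<Sum>n. ennreal (d n x)) \<partial>M) = (\<Sum>n. \<integral>\<^sup>+x. ennreal (d n x) \<partial>M)"
    by (rule nn_integral_suminf) measurable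
  also have "\<dots> \<le> (\<Sum>n. ennreal ((1/2) ^ n))"
    using d_int by (intro suminf_le) auto
  also have "\<dots> = ennreal (\<Sum>n. (1/2) ^ n)"
    by (intro suminf_ennreal_eq) (auto intro: summable_sums summable_geometric)
  also have "\<dots> < \<infinity>" by simp
  finally have "(\<integral>\<^sup>+x. (\<Sum>n. ennreal (d n x)) \<partial>M) \<noteq> \<infinity>" by simp
  then have "AE x in M. (\<Sum>n. ennreal (d n x)) \<noteq> \<infinity>"
    by (intro nn_integral_PInf_AE) measurable
  then have conv: "AE x in M. convergent (\<lambda>n. s n x)"
  proof eventually_elim
    case (elim x)
    have 1: "summable (\<lambda>n. d n x)"
      using d_nonneg elim by (intro summable_suminf_not_top) auto
    have bound: "norm (s (Suc n) x - s n x) \<le> d n x + (1/2) ^ n" for n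
    proof -
      define a where "a = \<bar>s (Suc n) x - s n x\<bar>"
      have "0 \<le> (2 ^ n * a - 1)\<^sup>2 / 2 ^ n" by simp
      also have "\<dots> = 2 ^ n * a\<^sup>2 - 2 * a + (1/2) ^ n"
        by (simp add: power2_eq_square field_simps)
      finally have "2 * a \<le> 2 ^ n * a\<^sup>2 + (1/2) ^ n" by simp
      moreover have "0 \<le> a" by (simp add: a_def)
      ultimately have "a \<le> 2 ^ n * a\<^sup>2 + (1/2) ^ n" by linarith
      then show ?thesis by (simp add: a_def d_def)
    qed
    have "summable (\<lambda>n. d n x + (1/2) ^ n)"
      using 1 by (intro summable_add summable_geometric) auto
    then have "summable (\<lambda>n. s (Suc n) x - s n x)"
      using bound by (rule summable_comparison_test'[where N=0])
    then have "convergent (\<lambda>n. \<Sum>i<n. s (Suc i) x - s i x)"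
      by (simp add: summable_iff_convergent)
    then have "convergent (\<lambda>n. s n x - s 0 x)"
      by (simp add: sum_lessThan_telescope[of "\<lambda>n. s n x" for x])
    then have "convergent (\<lambda>n. (s n x - s 0 x) + s 0 x)"
      by (intro convergent_add convergent_const)
    then show ?case by simp
  qed
  define g where "g x = lim (\<lambda>n. s n x)" for x
  have g_meas[measurable]: "g \<in> borel_measurable M"
    unfolding g_def by measurable
  have lim: "AE x in M. (\<lambda>n. s n x) \<longlonglongrightarrow> g x"
    using conv by eventually_elim (simp add: g_def convergent_LIMSEQ_iff)
  \<comment> \<open>Fatou's lemma carries the Cauchy bound over to the limit m to infinity. Its
    finiteness also shows that \<open>g - s n\<close>, and therefore \<open>g\<close>, is
    square-integrable.\<close>
  have fatou: "(\<integral>\<^sup>+x. ennreal ((g x - s n x)\<^sup>2) \<partial>M) \<le> ennreal ((1/4) ^ n)" for n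
  proof -
    have "(\<integral>\<^sup>+x. ennreal ((g x - s n x)\<^sup>2) \<partial>M)
        = (\<integral>\<^sup>+x. liminf (\<lambda>m. ennreal ((s m x - s n x)\<^sup>2)) \<partial>M)"
    proof (rule nn_integral_cong_AE)
      show "AE x in M. ennreal ((g x - s n x)\<^sup>2) = liminf (\<lambda>m. ennreal ((s m x - s n x)\<^sup>2))"
        using lim
      proof eventually_elim
        case (elim x)
        then have "(\<lambda>m. ennreal ((s m x - s n x)\<^sup>2)) \<longlonglongrightarrow> ennreal ((g x - s n x)\<^sup>2)"
          by (intro tendsto_intros)
        then show ?case by (intro lim_imp_Liminf[symmetric]) auto
      qed
    qed
    also have "\<dots> \<le> liminf (\<lambda>m. \<integral>\<^sup>+x. ennreal ((s m x - s n x)\<^sup>2) \<partial>M)"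
      by (rule nn_integral_liminf) measurable
    also have "\<dots> \<le> liminf (\<lambda>m. ennreal ((1/4) ^ n))"
    proof (rule Liminf_mono)
      show "\<forall>\<^sub>F m in sequentially. (\<integral>\<^sup>+x. ennreal ((s m x - s n x)\<^sup>2) \<partial>M) \<le> ennreal ((1/4) ^ n)"
        using eventually_ge_at_top[of n]
        by eventually_elim (use cauchy in \<open>auto simp: nn_integral_L2[OF L2_diff[OF s s]] intro!: ennreal_leI\<close>)
    qed
    also have "\<dots> = ennreal ((1/4) ^ n)" by (simp add: Liminf_const)
    finally show ?thesis .
  qed
  have diff: "(\<lambda>x. g x - s n x) \<in> L2_space M" for n
    unfolding L2_space_def using le_less_trans[OF fatou[of n] ennreal_less_top]
    by (auto intro!: integrableI_bounded)
  have "g \<in> L2_space M"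
    using L2_add[OF diff s, of 0 0] by simp
  moreover have "L2_inner M (\<lambda>x. g x - s n x) (\<lambda>x. g x - s n x) \<le> (1/4) ^ n" for n
    using fatou[of n] by (simp add: nn_integral_L2[OF diff])
  ultimately show ?thesis by (rule that)
qed

section \<open>Orthonormal bases\<close>

text \<open>The family is indexed so that the same results serve the eigenbases, indexed by
  frequencies, and an arbitrary basis set \<open>B\<close>, indexed by itself. Completeness is
  stated as triviality of the orthogonal complement, as in \<open>L2_orthonormal_basis\<close>; that
  expansions converge is derived below.\<close>

locale L2_basis =
  fixes M :: "'a measure" and I :: "'i set" and \<phi> :: "'i \<Rightarrow> 'a \<Rightarrow> real"
  assumes basis_L2: "i \<in> I \<Longrightarrow> \<phi> i \<in> L2_space M"
    and orthonormal: "i \<in> I \<Longrightarrow> j \<in> I \<Longrightarrow> L2_inner M (\<phi> i) (\<phi> j) = (if i = j then 1 else 0)"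
    and total: "f \<in> L2_space M \<Longrightarrow> (\<And>i. i \<in> I \<Longrightarrow> L2_inner M f (\<phi> i) = 0) \<Longrightarrow> AE x in M. f x = 0"
begin

lemma inner_combination_basis:
  assumes "finite F" "F \<subseteq> I" "i \<in> I"
  shows "L2_inner M (\<lambda>x. \<Sum>j\<in>F. a j * \<phi> j x) (\<phi> i) = (if i \<in> F then a i else 0)"
proof -
  have "L2_inner M (\<lambda>x. \<Sum>j\<in>F. a j * \<phi> j x) (\<phi> i) = (\<Sum>j\<in>F. a j * L2_inner M (\<phi> j) (\<phi> i))"
    using assms by (intro L2_inner_sum_left) (auto intro: basis_L2)
  also have "\<dots> = (\<Sum>j\<in>F. if j = i then a i else 0)"
    using assms by (intro sum.cong) (auto simp: orthonormal subset_iff)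
  finally show ?thesis using assms by simp
qed

lemma inner_combination_self:
  assumes "finite F" "F \<subseteq> I"
  shows "L2_inner M (\<lambda>x. \<Sum>j\<in>F. a j * \<phi> j x) (\<lambda>x. \<Sum>j\<in>F. a j * \<phi> j x) = (\<Sum>j\<in>F. (a j)\<^sup>2)"
proof -
  have "L2_inner M (\<lambda>x. \<Sum>j\<in>F. a j * \<phi> j x) (\<lambda>x. \<Sum>j\<in>F. a j * \<phi> j x)
      = (\<Sum>i\<in>F. a i * L2_inner M (\<phi> i) (\<lambda>x. \<Sum>j\<in>F. a j * \<phi> j x))"
    using assms by (intro L2_inner_sum_left L2_sum L2_scale) (auto intro: basis_L2)
  also have "\<dots> = (\<Sum>i\<in>F. (a i)\<^sup>2)"
    using assms inner_combination_basis[OF assms]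
    by (intro sum.cong) (auto simp: power2_eq_square subset_iff L2_inner_commute[of M "\<phi> _"])
  finally show ?thesis .
qed

text \<open>Pythagoras: the projection \<open>p\<close> satisfies <p, p> = <p, f>, so the cross
  terms collapse. Nonnegativity of the left side is Bessel's inequality.\<close>

lemma inner_remainder:
  assumes "finite F" "F \<subseteq> I" and f: "f \<in> L2_space M"
  defines "r \<equiv> \<lambda>x. f x - (\<Sum>j\<in>F. L2_inner M f (\<phi> j) * \<phi> j x)"
  shows "L2_inner M r r = L2_inner M f f - (\<Sum>j\<in>F. (L2_inner M f (\<phi> j))\<^sup>2)"
proof -
  define p where "p = (\<lambda>x. \<Sum>j\<in>F. L2_inner M f (\<phi> j) * \<phi> j x)"
  have p: "p \<in> L2_space M"
    unfolding p_def using assms by (intro L2_sum L2_scale) (auto intro: basis_L2)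
  have pp: "L2_inner M p p = (\<Sum>j\<in>F. (L2_inner M f (\<phi> j))\<^sup>2)"
    unfolding p_def using assms by (intro inner_combination_self)
  have "L2_inner M p f = (\<Sum>j\<in>F. L2_inner M f (\<phi> j) * L2_inner M (\<phi> j) f)"
    unfolding p_def using assms by (intro L2_inner_sum_left) (auto intro: basis_L2)
  then have pf: "L2_inner M p f = (\<Sum>j\<in>F. (L2_inner M f (\<phi> j))\<^sup>2)"
    by (simp add: power2_eq_square L2_inner_commute[of M _ f])
  have "r = (\<lambda>x. f x - p x)" by (simp add: r_def p_def)
  then show ?thesis
    using f p pp pf by (simp add: L2_inner_diff_left L2_inner_diff_right L2_diff L2_inner_commute[of M f p])
qed

lemma bessel_finite:
  assumes "finite F" "F \<subseteq> I" "f \<in> L2_space M"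
  shows "(\<Sum>i\<in>F. (L2_inner M f (\<phi> i))\<^sup>2) \<le> L2_inner M f f"
proof -
  have "0 \<le> L2_inner M f f - (\<Sum>j\<in>F. (L2_inner M f (\<phi> j))\<^sup>2)"
    unfolding inner_remainder[OF assms, symmetric] by (rule L2_inner_self_nonneg)
  then show ?thesis by simp
qed

lemma summable_coefficients:
  assumes "f \<in> L2_space M"
  shows "(\<lambda>i. (L2_inner M f (\<phi> i))\<^sup>2) summable_on I"
  using assms by (intro nonneg_bdd_above_summable_on) (auto intro!: bdd_aboveI2 bessel_finite)

text \<open>The finite partial sums, taken along exhausting index sets, form the Cauchy sequence.\<close>

lemma riesz_fischer:
  assumes summ: "(\<lambda>i. (a i)\<^sup>2) summable_on I"
  obtains g where "g \<in> L2_space M" "\<And>i. i \<in> I \<Longrightarrow> L2_inner M g (\<phi> i) = a i"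
    "L2_inner M g g \<le> (\<Sum>\<^sub>\<infinity>i\<in>I. (a i)\<^sup>2)"
proof -
  define S where "S = (\<Sum>\<^sub>\<infinity>i\<in>I. (a i)\<^sup>2)"
  have "\<exists>F. finite F \<and> F \<subseteq> I \<and> S - (\<Sum>i\<in>F. (a i)\<^sup>2) \<le> (1/4) ^ n" for n
  proof -
    obtain F where "finite F" "F \<subseteq> I" "dist (\<Sum>i\<in>F. (a i)\<^sup>2) S \<le> (1/4) ^ n"
      using infsum_finite_approximation[OF summ, of "(1/4) ^ n"] unfolding S_def by auto
    then show ?thesis by (intro exI[of _ F]) (auto simp: dist_real_def)
  qed
  then obtain F0 where F0: "\<And>n. finite (F0 n)" "\<And>n. F0 n \<subseteq> I"
    "\<And>n. S - (\<Sum>i\<in>F0 n. (a i)\<^sup>2) \<le> (1/4) ^ n"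
    by metis
  \<comment> \<open>Unions make the index sets nested, so that \<open>s m - s n\<close> is again a
    combination of basis vectors, over \<open>F m - F n\<close>, while the tail estimate
    survives.\<close>
  define F where "F n = (\<Union>k\<le>n. F0 k)" for n
  have F: "finite (F n)" "F n \<subseteq> I" for n
    using F0 by (auto simp: F_def)
  have F_mono: "F n \<subseteq> F m" if "n \<le> m" for n m
    unfolding F_def using that by (intro UN_mono) auto
  have sum_le: "(\<Sum>i\<in>G. (a i)\<^sup>2) \<le> S" if "finite G" "G \<subseteq> I" for G
    unfolding S_def using that summ by (intro finite_sum_le_infsum) auto
  have tail: "S - (\<Sum>i\<in>F n. (a i)\<^sup>2) \<le> (1/4) ^ n" for n
  proof -
    have "(\<Sum>i\<in>F0 n. (a i)\<^sup>2) \<le> (\<Sum>i\<in>F n. (a i)\<^sup>2)"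
      using F by (intro sum_mono2) (auto simp: F_def)
    with F0(3)[of n] show ?thesis by linarith
  qed
  define s where "s n = (\<lambda>x. \<Sum>i\<in>F n. a i * \<phi> i x)" for n
  have s: "s n \<in> L2_space M" for n
    unfolding s_def using F by (intro L2_sum L2_scale) (auto intro: basis_L2)
  have "L2_inner M (\<lambda>x. s m x - s n x) (\<lambda>x. s m x - s n x) \<le> (1/4) ^ n" if "n \<le> m" for n m
  proof -
    have "(\<lambda>x. s m x - s n x) = (\<lambda>x. \<Sum>i\<in>F m - F n. a i * \<phi> i x)"
      unfolding s_def using F F_mono[OF that] by (simp add: sum_diff)
    then have "L2_inner M (\<lambda>x. s m x - s n x) (\<lambda>x. s m x - s n x) = (\<Sum>i\<in>F m - F n. (a i)\<^sup>2)"
      using F[of m] by (simp add: inner_combination_self subset_iff)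
    also have "\<dots> = (\<Sum>i\<in>F m. (a i)\<^sup>2) - (\<Sum>i\<in>F n. (a i)\<^sup>2)"
      using F F_mono[OF that] by (simp add: sum_diff)
    also have "\<dots> \<le> (1/4) ^ n"
      using tail[of n] sum_le[OF F, of m] by linarith
    finally show ?thesis .
  qed
  then obtain g where g: "g \<in> L2_space M"
    "\<And>n. L2_inner M (\<lambda>x. g x - s n x) (\<lambda>x. g x - s n x) \<le> (1/4) ^ n"
    using L2_complete[of s M, OF s] by blast
  have coeff: "L2_inner M g (\<phi> i) = a i" if i: "i \<in> I" for i
  proof -
    \<comment> \<open>Two errors of at most (1/2)^n each: Bessel for the single index i bounds the
      coefficient of \<open>g - s n\<close>, and the coefficient of \<open>s n\<close> is either
      exactly \<open>a i\<close> or 0, in which case \<open>(a i)\<^sup>2\<close> is part of the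
      tail outside \<open>F n\<close>.\<close>
    have b: "\<bar>L2_inner M g (\<phi> i) - a i\<bar> \<le> 2 * (1/2) ^ n" for n
    proof -
      have "(L2_inner M (\<lambda>x. g x - s n x) (\<phi> i))\<^sup>2 \<le> (1/4) ^ n"
        using bessel_finite[of "{i}", OF _ _ L2_diff[OF g(1) s[of n]]] i g(2)[of n] by simp
      also have "(1/4) ^ n = ((1/2::real) ^ n)\<^sup>2"
        by (rule quarter_power)
      finally have 1: "\<bar>L2_inner M (\<lambda>x. g x - s n x) (\<phi> i)\<bar> \<le> (1/2) ^ n"
        by (subst (asm) abs_le_square_iff[symmetric]) simp
      have "\<bar>(if i \<in> F n then a i else 0) - a i\<bar> \<le> (1/2) ^ n"
      proof (cases "i \<in> F n")
        case False
        have "(a i)\<^sup>2 + (\<Sum>j\<in>F n. (a j)\<^sup>2) \<le> S"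
          using sum_le[of "insert i (F n)"] F[of n] i False by simp
        with tail[of n] have "(a i)\<^sup>2 \<le> (1/4) ^ n" by linarith
        also have "(1/4) ^ n = ((1/2::real) ^ n)\<^sup>2"
          by (rule quarter_power)
        finally show ?thesis using False
          by (subst (asm) abs_le_square_iff[symmetric]) simp
      qed simp
      then have 2: "\<bar>L2_inner M (s n) (\<phi> i) - a i\<bar> \<le> (1/2) ^ n"
        unfolding s_def using inner_combination_basis[OF F i] by simp
      have "L2_inner M (\<lambda>x. g x - s n x) (\<phi> i) = L2_inner M g (\<phi> i) - L2_inner M (s n) (\<phi> i)"
        using g s i by (intro L2_inner_diff_left basis_L2)
      with 1 2 show ?thesis by linarith
    qed
    have "(\<lambda>n. 2 * (1/2::real) ^ n) \<longlonglongrightarrow> 2 * 0"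
      by (intro tendsto_intros LIMSEQ_realpow_zero) auto
    then have "\<bar>L2_inner M g (\<phi> i) - a i\<bar> \<le> 2 * 0"
      by (rule LIMSEQ_le_const) (use b in auto)
    then show ?thesis by simp
  qed
  \<comment> \<open>By \<open>coeff\<close>, \<open>s n\<close> is the projection of
    \<open>g\<close> onto the span over \<open>F n\<close>, so \<open>inner_remainder\<close>
    evaluates the distance exactly.\<close>
  have "L2_inner M g g \<le> S + (1/4) ^ n" for n
  proof -
    have "s n = (\<lambda>x. \<Sum>j\<in>F n. L2_inner M g (\<phi> j) * \<phi> j x)"
      unfolding s_def using F[of n] coeff by (intro ext sum.cong) auto
    moreover have "(\<Sum>j\<in>F n. (L2_inner M g (\<phi> j))\<^sup>2) = (\<Sum>j\<in>F n. (a j)\<^sup>2)"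
      using F(2)[of n] coeff by (intro sum.cong) auto
    ultimately have "L2_inner M (\<lambda>x. g x - s n x) (\<lambda>x. g x - s n x)
        = L2_inner M g g - (\<Sum>j\<in>F n. (a j)\<^sup>2)"
      using inner_remainder[OF F g(1), of n] by simp
    with g(2)[of n] sum_le[OF F, of n] show ?thesis by simp
  qed
  moreover have "(\<lambda>n. S + (1/4::real) ^ n) \<longlonglongrightarrow> S + 0"
    by (intro tendsto_intros LIMSEQ_realpow_zero) auto
  ultimately have "L2_inner M g g \<le> S"
    using LIMSEQ_le_const[of "\<lambda>n. S + (1/4::real) ^ n" S "L2_inner M g g"] by auto
  with g(1) coeff show ?thesis unfolding S_def by (rule that)
qed

text \<open>The function rebuilt from the coefficients of f has the same coefficients, hence equals
  f almost everywhere by \<open>total\<close>. The norm bound in \<open>riesz_fischer\<close> then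
  gives the inequality opposite to Bessel's.\<close>

lemma parseval_self:
  assumes f: "f \<in> L2_space M"
  shows "((\<lambda>i. (L2_inner M f (\<phi> i))\<^sup>2) has_sum L2_inner M f f) I"
proof -
  note summ = summable_coefficients[OF f]
  obtain g where g: "g \<in> L2_space M" "\<And>i. i \<in> I \<Longrightarrow> L2_inner M g (\<phi> i) = L2_inner M f (\<phi> i)"
    "L2_inner M g g \<le> (\<Sum>\<^sub>\<infinity>i\<in>I. (L2_inner M f (\<phi> i))\<^sup>2)"
    by (rule riesz_fischer[OF summ]) blast
  have "AE x in M. f x - g x = 0"
    using f g by (intro total L2_diff) (auto simp: L2_inner_diff_left basis_L2)
  then have AE: "AE x in M. f x = g x" by simp
  have "L2_inner M f f = L2_inner M g g"
    using L2_inner_cong_AE[OF f g(1) f AE] L2_inner_cong_AE[OF f g(1) g(1) AE]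
    by (simp add: L2_inner_commute)
  moreover have "(\<Sum>\<^sub>\<infinity>i\<in>I. (L2_inner M f (\<phi> i))\<^sup>2) \<le> L2_inner M f f"
    using summ f by (intro infsum_le_finite_sums bessel_finite)
  ultimately have "(\<Sum>\<^sub>\<infinity>i\<in>I. (L2_inner M f (\<phi> i))\<^sup>2) = L2_inner M f f"
    using g(3) by linarith
  with has_sum_infsum[OF summ] show ?thesis by simp
qed

text \<open>Polarisation of \<open>parseval_self\<close>.\<close>

lemma parseval:
  assumes f: "f \<in> L2_space M" and g: "g \<in> L2_space M"
  shows "((\<lambda>i. L2_inner M f (\<phi> i) * L2_inner M g (\<phi> i)) has_sum L2_inner M f g) I"
proof -
  have "((\<lambda>i. ((L2_inner M (\<lambda>x. f x + g x) (\<phi> i))\<^sup>2 + - (L2_inner M (\<lambda>x. f x - g x) (\<phi> i))\<^sup>2) / 4)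
      has_sum (L2_inner M (\<lambda>x. f x + g x) (\<lambda>x. f x + g x)
        + - L2_inner M (\<lambda>x. f x - g x) (\<lambda>x. f x - g x)) / 4) I"
    by (intro has_sum_divide_const has_sum_add has_sum_uminusI parseval_self L2_add L2_diff f g)
  also have "(L2_inner M (\<lambda>x. f x + g x) (\<lambda>x. f x + g x)
        + - L2_inner M (\<lambda>x. f x - g x) (\<lambda>x. f x - g x)) / 4 = L2_inner M f g"
    using L2_inner_polarise[OF f g] by simp
  finally show ?thesis
    by (rule has_sum_cong[THEN iffD1, rotated])
      (simp add: L2_inner_add_left L2_inner_diff_left f g basis_L2 power2_sum power2_diff)
qed

end

section \<open>Traces of diagonal operators\<close>

lemma L2_basis_of_orthonormal_basis:
  assumes "L2_orthonormal_basis M B"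
  shows "L2_basis M B (\<lambda>e. e)"
  using assms by unfold_locales (auto simp: L2_orthonormal_basis_def)

context L2_basis
begin

lemma inj_on_basis: "inj_on \<phi> I"
proof (rule inj_onI)
  fix i j assume ij: "i \<in> I" "j \<in> I" "\<phi> i = \<phi> j"
  then have "L2_inner M (\<phi> i) (\<phi> j) = 1" using orthonormal[of i i] by simp
  with ij show "i = j" using orthonormal[of i j] by (auto split: if_splits)
qed

lemma orthonormal_basis_image: "L2_orthonormal_basis M (\<phi> ` I)"
  unfolding L2_orthonormal_basis_def
  using inj_on_basis by (auto simp: basis_L2 orthonormal inj_on_eq_iff intro: total)

text \<open>Without any orthonormal basis every number would be a trace vacuously; the basis of the
  locale is what makes the description in \<open>L2_trace\<close> unique.\<close>

lemma L2_trace_eqI: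
  assumes "has_L2_trace M A t"
  shows "L2_trace M A = t"
  unfolding L2_trace_def
proof (rule the_equality)
  show "has_L2_trace M A t" by fact
  fix s assume "has_L2_trace M A s"
  with assms show "s = t"
    using orthonormal_basis_image unfolding has_L2_trace_def by (meson has_sum_unique)
qed

text \<open>Both iterated sums of \<open>\<mu> i * \<langle>e, \<phi> i\<rangle>\<^sup>2\<close> are evaluated by Parseval's identity, once for the
  eigenbasis and once for the arbitrary basis.\<close>

lemma has_L2_trace_diagonal:
  assumes A: "\<And>f. f \<in> L2_space M \<Longrightarrow> A f \<in> L2_space M"
    and diag: "\<And>f i. f \<in> L2_space M \<Longrightarrow> i \<in> I \<Longrightarrow> L2_inner M (A f) (\<phi> i) = \<mu> i * L2_inner M f (\<phi> i)"
    and nonneg: "\<And>i. i \<in> I \<Longrightarrow> 0 \<le> \<mu> i"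
    and t: "(\<mu> has_sum t) I"
  shows "has_L2_trace M A t"
  unfolding has_L2_trace_def
proof (intro allI impI)
  fix B assume "L2_orthonormal_basis M B"
  then interpret B: L2_basis M B "\<lambda>e. e" by (rule L2_basis_of_orthonormal_basis)
  define F where "F = (\<lambda>(i, e). \<mu> i * (L2_inner M e (\<phi> i))\<^sup>2)"
  have inner: "((\<lambda>e. F (i, e)) has_sum \<mu> i) B" if "i \<in> I" for i
  proof -
    have "((\<lambda>e. \<mu> i * (L2_inner M (\<phi> i) e)\<^sup>2) has_sum \<mu> i * L2_inner M (\<phi> i) (\<phi> i)) B"
      using that by (intro has_sum_cmult_right B.parseval_self basis_L2)
    moreover have "F (i, e) = \<mu> i * (L2_inner M (\<phi> i) e)\<^sup>2" for e
      by (simp add: F_def L2_inner_commute[of M e "\<phi> i"])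
    ultimately show ?thesis
      using that by (simp add: orthonormal)
  qed
  \<comment> \<open>Since \<open>\<mu>\<close> is nonnegative, so is \<open>F\<close>, and
    summability of the iterated sums suffices for summability on the product. This licenses the
    interchange below.\<close>
  have "F summable_on I \<times> B"
    using t inner nonneg by (intro summable_on_SigmaI[where g = \<mu>])
      (auto simp: F_def dest: has_sum_imp_summable)
  then have "(F has_sum t) (I \<times> B)"
    using inner t by (intro has_sum_SigmaI[where g = \<mu>])
  then have "((\<lambda>(e, i). F (i, e)) has_sum t) (B \<times> I)"
    by (rule has_sum_swap[THEN iffD1])
  moreover have "((\<lambda>i. (\<lambda>(e, i). F (i, e)) (e, i)) has_sum L2_inner M (A e) e) I" if "e \<in> B" for e
    using parseval[OF A[OF B.basis_L2[OF that]] B.basis_L2[OF that]]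
    by (rule has_sum_cong[THEN iffD1, rotated])
      (simp add: F_def diag B.basis_L2[OF that] power2_eq_square)
  ultimately show "((\<lambda>e. L2_inner M (A e) e) has_sum t) B"
    by (rule has_sum_SigmaD)
qed

end

text \<open>Up to null sets, the graph is characterised by its action on coefficients.
  \<open>graph_complete\<close> asks only for some g' equal to g almost everywhere: the discrete
  graph fixes its second component as a function, also outside the torus, whereas g is known only
  modulo null sets.\<close>

locale diagonal_operator = L2_basis M I \<phi>
  for M :: "'a measure" and I :: "'i set" and \<phi> :: "'i \<Rightarrow> 'a \<Rightarrow> real" +
  fixes T :: "(('a \<Rightarrow> real) \<times> ('a \<Rightarrow> real)) set" and ev :: "'i \<Rightarrow> real"
  assumes ev_nonneg: "i \<in> I \<Longrightarrow> 0 \<le> ev i"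
    and range_L2: "(u, g) \<in> T \<Longrightarrow> u \<in> L2_space M \<Longrightarrow> g \<in> L2_space M"
    and graph_coefficients: "(u, g) \<in> T \<Longrightarrow> u \<in> L2_space M \<Longrightarrow> i \<in> I \<Longrightarrow>
      L2_inner M g (\<phi> i) = ev i * L2_inner M u (\<phi> i)"
    and graph_complete: "u \<in> L2_space M \<Longrightarrow> g \<in> L2_space M \<Longrightarrow>
      (\<And>i. i \<in> I \<Longrightarrow> L2_inner M g (\<phi> i) = ev i * L2_inner M u (\<phi> i)) \<Longrightarrow>
      \<exists>g'. (u, g') \<in> T \<and> (AE x in M. g' x = g x)"
begin

text \<open>Dividing the coefficients of f by ev i + c, which is at least c, keeps them
  square-summable, so \<open>riesz_fischer\<close> yields a solution. Whatever solution the choice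
  operator selects, its coefficients are forced by the equation.\<close>

lemma resolvent_diagonal:
  assumes c: "0 < c" and f: "f \<in> L2_space M"
  shows "resolvent M T c f \<in> L2_space M"
    and "i \<in> I \<Longrightarrow> L2_inner M (resolvent M T c f) (\<phi> i) = 1 / (ev i + c) * L2_inner M f (\<phi> i)"
proof -
  have pos: "0 < ev i + c" if "i \<in> I" for i
    using ev_nonneg[OF that] c by linarith
  define a where "a i = 1 / (ev i + c) * L2_inner M f (\<phi> i)" for i
  have "(\<lambda>i. (a i)\<^sup>2) summable_on I"
  proof (rule summable_on_comparison_test)
    show "(\<lambda>i. (1 / c)\<^sup>2 * (L2_inner M f (\<phi> i))\<^sup>2) summable_on I"
      by (intro summable_on_cmult_right summable_coefficients f)
    show "(a i)\<^sup>2 \<le> (1 / c)\<^sup>2 * (L2_inner M f (\<phi> i))\<^sup>2" if "i \<in> I" for i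
      unfolding a_def power_mult_distrib using that c ev_nonneg[OF that] pos[OF that]
      by (intro mult_right_mono power_mono divide_left_mono) auto
  qed auto
  then obtain u where u: "u \<in> L2_space M" "\<And>i. i \<in> I \<Longrightarrow> L2_inner M u (\<phi> i) = a i"
    by (rule riesz_fischer) blast
  \<comment> \<open>The only candidate for T u in T u + c u = f.\<close>
  define g where "g = (\<lambda>x. f x - c * u x)"
  have g: "g \<in> L2_space M" unfolding g_def by (intro L2_diff L2_scale f u)
  have "L2_inner M g (\<phi> i) = ev i * L2_inner M u (\<phi> i)" if "i \<in> I" for i
  proof -
    have "L2_inner M g (\<phi> i) = L2_inner M f (\<phi> i) - c * a i"
      unfolding g_def using that by (simp add: L2_inner_diff_left L2_inner_scale_left f u basis_L2 L2_scale)
    also have "\<dots> = ev i * a i"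
      using pos[OF that] by (simp add: a_def field_simps)
    finally show ?thesis using u that by simp
  qed
  then obtain g' where g': "(u, g') \<in> T" "AE x in M. g' x = g x"
    using graph_complete[OF u(1) g] by blast
  from g'(2) have "AE x in M. g' x + c * u x = f x"
    by eventually_elim (simp add: g_def)
  with u(1) g'(1) have "\<exists>u. u \<in> L2_space M \<and> (\<exists>g. (u, g) \<in> T \<and> (AE x in M. g x + c * u x = f x))"
    by blast
  \<comment> \<open>The chosen solution need not be the \<open>u\<close> constructed above; from
    here on only its defining property is available.\<close>
  from someI_ex[OF this, folded resolvent_def] obtain h where R: "resolvent M T c f \<in> L2_space M"
    "(resolvent M T c f, h) \<in> T" "AE x in M. h x + c * resolvent M T c f x = f x"
    by blast
  show "resolvent M T c f \<in> L2_space M" by fact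
  assume i: "i \<in> I"
  have h: "h \<in> L2_space M" by (rule range_L2[OF R(2,1)])
  have "L2_inner M f (\<phi> i) = L2_inner M (\<lambda>x. h x + c * resolvent M T c f x) (\<phi> i)"
    using L2_inner_cong_AE[OF _ f basis_L2[OF i] R(3)] by (simp add: L2_add L2_scale R h)
  also have "\<dots> = (ev i + c) * L2_inner M (resolvent M T c f) (\<phi> i)"
    using i by (simp add: L2_inner_add_left L2_inner_scale_left L2_scale R h basis_L2
        graph_coefficients[OF R(2,1)] algebra_simps)
  finally show "L2_inner M (resolvent M T c f) (\<phi> i) = 1 / (ev i + c) * L2_inner M f (\<phi> i)"
    using pos[OF i] by simp
qed

lemma resolvent_power_diagonal:
  assumes c: "0 < c" and f: "f \<in> L2_space M"
  shows "(resolvent M T c ^^ p) f \<in> L2_space M \<and> (\<forall>i\<in>I.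
    L2_inner M ((resolvent M T c ^^ p) f) (\<phi> i) = 1 / (ev i + c) ^ p * L2_inner M f (\<phi> i))"
  by (induction p) (auto simp: f resolvent_diagonal[OF c])

lemma has_L2_trace_resolvent_power:
  assumes c: "0 < c" and t: "((\<lambda>i. 1 / (ev i + c) ^ p) has_sum t) I"
  shows "has_L2_trace M (resolvent M T c ^^ p) t"
proof (rule has_L2_trace_diagonal[OF _ _ _ t])
  show "0 \<le> 1 / (ev i + c) ^ p" if "i \<in> I" for i
    using ev_nonneg[OF that] c by simp
qed (use resolvent_power_diagonal[OF c] in auto)

end

section \<open>The discrete torus\<close>

definition cas :: "real \<Rightarrow> real" where
  "cas t = cos t + sin t"

text \<open>Source of all orthogonality relations: the cosine is the real part of the character of
  the difference, the sine the imaginary part of the character of the sum, and the latter averages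
  to zero for every frequency.\<close>

lemma cas_mult: "cas a * cas b = cos (a - b) + sin (a + b)"
  by (simp add: cas_def cos_diff sin_add algebra_simps)

text \<open>This makes cas an eigenfunction of the second difference.\<close>

lemma cas_add_diff: "cas (a + h) + cas (a - h) = 2 * cos h * cas a"
  by (simp add: cas_def cos_diff sin_add cos_add sin_diff algebra_simps)

lemma cas_eq_cis: "cas t = Re (cis t) + Im (cis t)"
  by (simp add: cas_def)

definition idot :: "int ^ 'm::finite \<Rightarrow> int ^ 'm \<Rightarrow> int" where
  "idot k v = (\<Sum>i\<in>UNIV. k $ i * v $ i)"

lemma idot_commute: "idot k v = idot v k"
  by (simp add: idot_def mult.commute)

lemma idot_diff_left: "idot (k - l) v = idot k v - idot l v"
  by (simp add: idot_def left_diff_distrib sum_subtractf)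

lemma idot_add_left: "idot (k + l) v = idot k v + idot l v"
  by (simp add: idot_def distrib_right sum.distrib)

text \<open>Cyclic translation by a in coordinate i, a bijection of the discrete torus. It supplies
  both the root-of-unity argument and summation by parts.\<close>

definition torus_shift :: "nat \<Rightarrow> 'm::finite \<Rightarrow> int \<Rightarrow> int ^ 'm \<Rightarrow> int ^ 'm" where
  "torus_shift n i a v = (\<chi> j. if j = i then (v $ i + a) mod int n else v $ j)"

lemma finite_discrete_torus: "finite (discrete_torus n :: (int ^ 'm::finite) set)"
proof (rule finite_subset)
  show "(discrete_torus n :: (int ^ 'm) set) \<subseteq> (\<lambda>f. \<chi> i. f i) ` (UNIV \<rightarrow>\<^sub>E {0..<int n})"
  proof
    fix v :: "int ^ 'm" assume "v \<in> discrete_torus n"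
    then have "(\<lambda>i. v $ i) \<in> UNIV \<rightarrow>\<^sub>E {0..<int n}" by (auto simp: discrete_torus_def)
    then show "v \<in> (\<lambda>f. \<chi> i. f i) ` (UNIV \<rightarrow>\<^sub>E {0..<int n})"
      by (intro image_eqI[where x = "\<lambda>i. v $ i"]) auto
  qed
  show "finite ((\<lambda>f. \<chi> i. f i) ` ((UNIV :: 'm set) \<rightarrow>\<^sub>E {0..<int n}))"
    by (intro finite_imageI finite_PiE) auto
qed

lemma torus_shift_in: "n \<ge> 1 \<Longrightarrow> v \<in> discrete_torus n \<Longrightarrow> torus_shift n i a v \<in> discrete_torus n"
  by (auto simp: torus_shift_def discrete_torus_def)

lemma torus_shift_inverse:
  "v \<in> discrete_torus n \<Longrightarrow> a + b = 0 \<Longrightarrow> torus_shift n i a (torus_shift n i b v) = v"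
  by (auto simp: torus_shift_def discrete_torus_def vec_eq_iff mod_simps add.assoc add.commute[of b])

text \<open>Reduction modulo n changes the pairing by a multiple of n, which the n-th roots of unity
  do not see.\<close>

lemma idot_torus_shift:
  obtains q where "idot k (torus_shift n i a v) = idot k v + k $ i * a + int n * q"
proof -
  have "torus_shift n i a v $ j = v $ j + (if j = i then a - int n * ((v $ i + a) div int n) else 0)" for j
    by (auto simp: torus_shift_def minus_div_mult_eq_mod[symmetric] mult.commute)
  then have "idot k (torus_shift n i a v)
      = idot k v + (\<Sum>j\<in>UNIV. if j = i then k $ i * (a - int n * ((v $ i + a) div int n)) else 0)"
    unfolding idot_def sum.distrib[symmetric] by (intro sum.cong) (auto simp: distrib_left)
  also have "\<dots> = idot k v + k $ i * a + int n * (- (k $ i) * ((v $ i + a) div int n))"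
    by (simp add: algebra_simps)
  finally show ?thesis by (rule that)
qed

lemma sum_torus_shift:
  assumes "n \<ge> 1"
  shows "(\<Sum>v\<in>discrete_torus n. h (torus_shift n i a v)) = (\<Sum>v\<in>discrete_torus n. h v)"
  by (rule sum.reindex_bij_witness[where i = "torus_shift n i (- a)" and j = "torus_shift n i a"])
    (use assms in \<open>auto simp: torus_shift_in torus_shift_inverse\<close>)

definition root_phase :: "nat \<Rightarrow> int \<Rightarrow> real" where
  "root_phase n a = 2 * pi * of_int a / n"

lemma root_phase_add: "root_phase n (a + b) = root_phase n a + root_phase n b"
  by (simp add: root_phase_def distrib_left add_divide_distrib)

lemma root_phase_diff: "root_phase n (a - b) = root_phase n a - root_phase n b"
  by (simp add: root_phase_def right_diff_distrib diff_divide_distrib)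

lemma cis_root_phase_eq_1_iff:
  assumes "n \<ge> 1"
  shows "cis (root_phase n a) = 1 \<longleftrightarrow> int n dvd a"
proof
  assume "int n dvd a"
  then obtain q where "a = int n * q" ..
  then have "root_phase n a = 2 * pi * of_int q" using assms by (simp add: root_phase_def)
  then show "cis (root_phase n a) = 1" by (simp add: cis_multiple_2pi)
next
  assume "cis (root_phase n a) = 1"
  then have "cos (root_phase n a) = 1" by (metis cis.sel(1) one_complex.sel(1))
  then obtain q :: int where "root_phase n a = of_int q * (2 * pi)"
    by (auto simp: cos_one_2pi_int)
  then have "real_of_int a = of_int (int n * q)"
    using assms by (simp add: root_phase_def field_simps)
  then have "a = int n * q" by (simp only: of_int_eq_iff)
  then show "int n dvd a" by simp
qed

lemma cis_root_phase_shift: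
  assumes "n \<ge> 1"
  shows "cis (root_phase n (idot k (torus_shift n i a v))) = cis (root_phase n (idot k v + k $ i * a))"
proof -
  obtain q where q: "idot k (torus_shift n i a v) = idot k v + k $ i * a + int n * q"
    by (rule idot_torus_shift)
  have "cis (root_phase n (int n * q)) = 1" using assms by (simp add: cis_root_phase_eq_1_iff)
  then show ?thesis unfolding q root_phase_add[of n _ "int n * q"]
    by (simp flip: cis_mult)
qed

text \<open>A shift in a coordinate i with n not dividing \<open>w $ i\<close> multiplies the sum by a nontrivial
  root of unity.\<close>

lemma sum_cis_discrete_torus:
  fixes w :: "int ^ 'm::finite"
  assumes n: "n \<ge> 1"
  shows "(\<Sum>v\<in>discrete_torus n. cis (root_phase n (idot w v)))
    = (if \<forall>i. int n dvd w $ i then of_nat (card (discrete_torus n :: (int ^ 'm) set)) else 0)"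
    (is "?S = _")
proof (cases "\<forall>i. int n dvd w $ i")
  case True
  have "cis (root_phase n (idot w v)) = 1" for v
    using n True by (simp add: cis_root_phase_eq_1_iff idot_def dvd_sum)
  then show ?thesis using True by simp
next
  case False
  then obtain i where i: "\<not> int n dvd w $ i" by blast
  have "?S = (\<Sum>v\<in>discrete_torus n. cis (root_phase n (idot w (torus_shift n i 1 v))))"
    using n by (rule sum_torus_shift[symmetric])
  also have "\<dots> = (\<Sum>v\<in>discrete_torus n. cis (root_phase n (w $ i)) * cis (root_phase n (idot w v)))"
    using n by (simp add: cis_root_phase_shift root_phase_add cis_mult add.commute)
  also have "\<dots> = cis (root_phase n (w $ i)) * ?S" by (simp add: sum_distrib_left)
  finally have "(1 - cis (root_phase n (w $ i))) * ?S = 0" by (simp add: left_diff_distrib)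
  moreover have "cis (root_phase n (w $ i)) \<noteq> 1" using i n by (simp add: cis_root_phase_eq_1_iff)
  ultimately have "?S = 0" by simp
  then show ?thesis using False by (simp del: de_Morgan_disj not_all)
qed

lemma sum_cas_cas_discrete_torus:
  fixes k l :: "int ^ 'm::finite"
  assumes n: "n \<ge> 1" and k: "k \<in> discrete_torus n" and l: "l \<in> discrete_torus n"
  shows "(\<Sum>v\<in>discrete_torus n. cas (root_phase n (idot k v)) * cas (root_phase n (idot l v)))
    = (if k = l then card (discrete_torus n :: (int ^ 'm) set) else 0)"
proof -
  \<comment> \<open>The character sum is a cardinality or 0, hence real in both cases; there is no
    need to know whether k + l vanishes modulo n.\<close>
  have Im: "Im (\<Sum>v\<in>discrete_torus n. cis (root_phase n (idot (k + l) v))) = 0"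
    unfolding sum_cis_discrete_torus[OF n] by simp
  have "(\<Sum>v\<in>discrete_torus n. cas (root_phase n (idot k v)) * cas (root_phase n (idot l v)))
      = Re (\<Sum>v\<in>discrete_torus n. cis (root_phase n (idot (k - l) v)))
      + Im (\<Sum>v\<in>discrete_torus n. cis (root_phase n (idot (k + l) v)))"
    by (simp add: cas_mult idot_diff_left idot_add_left root_phase_add root_phase_diff sum.distrib)
  also note Im
  moreover have "(\<forall>i. int n dvd (k - l) $ i) \<longleftrightarrow> k = l"
  proof
    assume d: "\<forall>i. int n dvd (k - l) $ i"
    have "k $ i = l $ i" for i
    proof -
      have "k $ i \<in> {0..<int n}" "l $ i \<in> {0..<int n}"
        using k l by (auto simp: discrete_torus_def)
      then have "\<bar>k $ i - l $ i\<bar> < int n" by auto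
      then show ?thesis using d dvd_imp_le_int[of "k $ i - l $ i" "int n"] by fastforce
    qed
    then show "k = l" by (simp add: vec_eq_iff)
  qed simp
  then have "Re (\<Sum>v\<in>discrete_torus n. cis (root_phase n (idot (k - l) v)))
    = (if k = l then card (discrete_torus n :: (int ^ 'm) set) else 0)"
    unfolding sum_cis_discrete_torus[OF n] by simp
  ultimately show ?thesis by simp
qed

text \<open>The normalised kernel of the m-dimensional discrete Hartley transform.\<close>

definition discrete_hartley :: "nat \<Rightarrow> int ^ 'm::finite \<Rightarrow> int ^ 'm \<Rightarrow> real" where
  "discrete_hartley n k v =
     cas (root_phase n (idot k v)) / sqrt (card (discrete_torus n :: (int ^ 'm) set))"

definition discrete_eigenvalue :: "nat \<Rightarrow> int ^ 'm::finite \<Rightarrow> real" where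
  "discrete_eigenvalue n k = (real n)\<^sup>2 / pi\<^sup>2 * (\<Sum>i\<in>UNIV. (sin (pi * of_int (k $ i) / n))\<^sup>2)"

lemma card_discrete_torus_pos:
  assumes "n \<ge> 1"
  shows "card (discrete_torus n :: (int ^ 'm::finite) set) > 0"
proof -
  have "(0 :: int ^ 'm) \<in> discrete_torus n" using assms by (simp add: discrete_torus_def)
  then show ?thesis using finite_discrete_torus card_gt_0_iff by blast
qed

lemma L2_space_discrete_torus: "f \<in> L2_space (count_space (discrete_torus n))"
  by (simp add: L2_space_def integrable_count_space finite_discrete_torus)

lemma L2_inner_discrete_torus:
  "L2_inner (count_space (discrete_torus n)) f g = (\<Sum>v\<in>discrete_torus n. f v * g v)"
  by (simp add: L2_inner_def lebesgue_integral_count_space_finite finite_discrete_torus)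

lemma discrete_hartley_shift:
  assumes "n \<ge> 1"
  shows "discrete_hartley n k (torus_shift n i 1 v) + discrete_hartley n k (torus_shift n i (-1) v)
    = 2 * cos (root_phase n (k $ i)) * discrete_hartley n k v"
proof -
  have "cas (root_phase n (idot k (torus_shift n i 1 v)))
      = cas (root_phase n (idot k v) + root_phase n (k $ i))"
    "cas (root_phase n (idot k (torus_shift n i (-1) v)))
      = cas (root_phase n (idot k v) - root_phase n (k $ i))"
    unfolding cas_eq_cis cis_root_phase_shift[OF assms]
    by (simp_all add: root_phase_add root_phase_diff)
  then show ?thesis
    unfolding discrete_hartley_def by (simp add: add_divide_distrib[symmetric] cas_add_diff)
qed

lemma combinatorial_laplacian_shift:
  "combinatorial_laplacian n u v = (\<Sum>i\<in>UNIV. (real n)\<^sup>2 / (4 * pi\<^sup>2) *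
     (2 * u v - u (torus_shift n i 1 v) - u (torus_shift n i (-1) v)))"
proof -
  have "(\<chi> j. if j = i then v $ i else v $ j) = v" for i
    by (auto simp: vec_eq_iff)
  then have "cycle_laplacian n (\<lambda>k. u (\<chi> j. if j = i then k else v $ j)) (v $ i)
      = (real n)\<^sup>2 / (4 * pi\<^sup>2) * (2 * u v - u (torus_shift n i 1 v) - u (torus_shift n i (-1) v))" for i
    unfolding cycle_laplacian_def torus_shift_def diff_conv_add_uminus[of "v $ i" 1, symmetric]
    by simp
  then show ?thesis
    unfolding combinatorial_laplacian_def by simp
qed

text \<open>Summation by parts: each shift moves from u to the mode, where
  \<open>discrete_hartley_shift\<close> evaluates the second difference, and 2 - 2 cos (2 x) = 4
  (sin x)^2 produces the eigenvalue.\<close>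

lemma inner_combinatorial_laplacian:
  fixes k :: "int ^ 'm::finite"
  assumes n: "n \<ge> 1"
  shows "(\<Sum>v\<in>discrete_torus n. combinatorial_laplacian n u v * discrete_hartley n k v)
    = discrete_eigenvalue n k * (\<Sum>v\<in>discrete_torus n. u v * discrete_hartley n k v)"
proof -
  let ?h = "discrete_hartley n k" and ?D = "discrete_torus n :: (int ^ 'm) set"
  let ?c = "(real n)\<^sup>2 / (4 * pi\<^sup>2)"
  have four_quarters: "?c * (4 * s) = (real n)\<^sup>2 / pi\<^sup>2 * s" for s
    by simp
  have shift: "(\<Sum>v\<in>?D. u (torus_shift n i a v) * ?h v) = (\<Sum>v\<in>?D. u v * ?h (torus_shift n i (- a) v))"
    for i a
  proof -
    have "(\<Sum>v\<in>?D. u v * ?h (torus_shift n i (- a) v))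
        = (\<Sum>v\<in>?D. u (torus_shift n i a v) * ?h (torus_shift n i (- a) (torus_shift n i a v)))"
      using sum_torus_shift[OF n, of "\<lambda>v. u v * ?h (torus_shift n i (- a) v)" i a] by simp
    then show ?thesis by (simp add: torus_shift_inverse)
  qed
  have "(\<Sum>v\<in>?D. combinatorial_laplacian n u v * ?h v)
      = (\<Sum>i\<in>UNIV. \<Sum>v\<in>?D. ?c *
          (2 * (u v * ?h v) - u (torus_shift n i 1 v) * ?h v - u (torus_shift n i (-1) v) * ?h v))"
    unfolding combinatorial_laplacian_shift sum_distrib_right
    by (subst sum.swap) (intro sum.cong refl, simp add: left_diff_distrib mult.assoc)
  also have "\<dots> = (\<Sum>i\<in>UNIV. ?c * (4 * (sin (pi * of_int (k $ i) / n))\<^sup>2) * (\<Sum>v\<in>?D. u v * ?h v))"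
  proof (rule sum.cong[OF refl])
    fix i :: 'm
    have alg: "c * (2 * s - (2 * x * s - t) - t) = c * (2 - 2 * x) * s" for c s x t :: real
      by (simp add: algebra_simps)
    have half: "2 - 2 * cos (root_phase n (k $ i)) = 4 * (sin (pi * of_int (k $ i) / n))\<^sup>2"
      using cos_double_sin[of "pi * of_int (k $ i) / n"] by (simp add: root_phase_def mult.assoc)
    have "(\<Sum>v\<in>?D. ?c *
          (2 * (u v * ?h v) - u (torus_shift n i 1 v) * ?h v - u (torus_shift n i (-1) v) * ?h v))
      = ?c * (2 * (\<Sum>v\<in>?D. u v * ?h v) - (\<Sum>v\<in>?D. u v * ?h (torus_shift n i (-1) v))
          - (\<Sum>v\<in>?D. u v * ?h (torus_shift n i 1 v)))"
      by (simp only: sum_distrib_left[symmetric] sum_subtractf shift minus_minus)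
    also have "(\<Sum>v\<in>?D. u v * ?h (torus_shift n i (-1) v)) =
        (\<Sum>v\<in>?D. u v * (2 * cos (root_phase n (k $ i)) * ?h v) - u v * ?h (torus_shift n i 1 v))"
      by (intro sum.cong refl) (simp only: discrete_hartley_shift[OF n, symmetric] right_diff_distrib[symmetric] add_diff_cancel_left')
    also have "\<dots> = 2 * cos (root_phase n (k $ i)) * (\<Sum>v\<in>?D. u v * ?h v)
        - (\<Sum>v\<in>?D. u v * ?h (torus_shift n i 1 v))"
      by (simp add: sum_subtractf sum_distrib_left mult_ac)
    also have "?c * (2 * (\<Sum>v\<in>?D. u v * ?h v) - (2 * cos (root_phase n (k $ i)) * (\<Sum>v\<in>?D. u v * ?h v)
        - (\<Sum>v\<in>?D. u v * ?h (torus_shift n i 1 v))) - (\<Sum>v\<in>?D. u v * ?h (torus_shift n i 1 v)))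
      = ?c * (2 - 2 * cos (root_phase n (k $ i))) * (\<Sum>v\<in>?D. u v * ?h v)"
      by (rule alg)
    finally show "(\<Sum>v\<in>?D. ?c *
          (2 * (u v * ?h v) - u (torus_shift n i 1 v) * ?h v - u (torus_shift n i (-1) v) * ?h v))
      = ?c * (4 * (sin (pi * of_int (k $ i) / n))\<^sup>2) * (\<Sum>v\<in>?D. u v * ?h v)"
      unfolding half .
  qed
  also have "\<dots> = discrete_eigenvalue n k * (\<Sum>v\<in>?D. u v * ?h v)"
    unfolding discrete_eigenvalue_def
    by (simp only: four_quarters sum_distrib_right[symmetric] sum_distrib_left[symmetric])
  finally show ?thesis .
qed

lemma diagonal_operator_combinatorial_laplacian:
  assumes n: "n \<ge> 1"
  shows "diagonal_operator (count_space (discrete_torus n :: (int ^ 'm::finite) set)) (discrete_torus n)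
    (discrete_hartley n) {(f, g). g = combinatorial_laplacian n f} (discrete_eigenvalue n)"
proof -
  let ?D = "discrete_torus n :: (int ^ 'm) set"
  let ?h = "discrete_hartley n :: int ^ 'm \<Rightarrow> _"
  have hh: "?h k v * ?h l w = cas (root_phase n (idot k v)) * cas (root_phase n (idot l w)) / card ?D"
    for k l v w
    by (simp add: discrete_hartley_def real_sqrt_mult_self)
  \<comment> \<open>Positions and frequencies range over the same finite set and the kernel is
    symmetric, so the orthogonality relation \<open>orth\<close> also says that the sum over k of h
    k v * h k w is a delta. Totality follows from this without a dimension count.\<close>
  have h_comm: "?h k v = ?h v k" for k v
    by (simp add: discrete_hartley_def idot_commute)
  have orth: "(\<Sum>v\<in>?D. ?h k v * ?h l v) = (if k = l then 1 else 0)" if "k \<in> ?D" "l \<in> ?D" for k l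
    unfolding hh sum_divide_distrib[symmetric] sum_cas_cas_discrete_torus[OF n that]
    using card_discrete_torus_pos[OF n, where 'm = 'm] by simp
  interpret L2_basis "count_space ?D" ?D ?h
  proof
    fix f :: "int ^ 'm \<Rightarrow> real"
    assume "\<And>k. k \<in> ?D \<Longrightarrow> L2_inner (count_space ?D) f (?h k) = 0"
    then have f: "(\<Sum>v\<in>?D. f v * ?h k v) = 0" if "k \<in> ?D" for k
      using that by (simp add: L2_inner_discrete_torus)
    have "f w = 0" if w: "w \<in> ?D" for w
    proof -
      have "f w = (\<Sum>v\<in>?D. f v * (\<Sum>k\<in>?D. ?h v k * ?h w k))"
        using w by (simp add: orth finite_discrete_torus if_distrib[of "\<lambda>x. f _ * x"] cong: if_cong)
      also have "\<dots> = (\<Sum>k\<in>?D. (\<Sum>v\<in>?D. f v * ?h k v) * ?h w k)"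
        unfolding sum_distrib_left sum_distrib_right
        by (subst sum.swap) (simp add: h_comm[of k for k] mult.assoc)
      also have "\<dots> = 0" by (simp add: f)
      finally show ?thesis .
    qed
    then show "AE w in count_space ?D. f w = 0" by (simp add: AE_count_space)
  qed (simp_all add: L2_space_discrete_torus L2_inner_discrete_torus orth)
  show ?thesis
  proof
    fix u g :: "int ^ 'm \<Rightarrow> real"
    assume eq: "\<And>k. k \<in> ?D \<Longrightarrow> L2_inner (count_space ?D) g (?h k)
      = discrete_eigenvalue n k * L2_inner (count_space ?D) u (?h k)"
    have "AE v in count_space ?D. combinatorial_laplacian n u v - g v = 0"
      by (intro total L2_space_discrete_torus)
        (simp add: L2_inner_diff_left L2_space_discrete_torus eq,
         simp add: L2_inner_discrete_torus inner_combinatorial_laplacian[OF n])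
    then show "\<exists>g'. (u, g') \<in> {(f, g). g = combinatorial_laplacian n f} \<and>
        (AE v in count_space ?D. g' v = g v)"
      by simp
  qed (auto simp: L2_space_discrete_torus L2_inner_discrete_torus inner_combinatorial_laplacian[OF n]
    discrete_eigenvalue_def intro!: divide_nonneg_nonneg mult_nonneg_nonneg sum_nonneg)
qed

lemma has_L2_trace_discrete_resolvent_power:
  assumes "n \<ge> 1" "z > 0"
  shows "has_L2_trace (count_space (discrete_torus n)) (discrete_resolvent_power n z :: (int ^ 'm::finite \<Rightarrow> real) \<Rightarrow> _)
    (\<Sum>k\<in>discrete_torus n. 1 / (discrete_eigenvalue n (k :: int ^ 'm) + z\<^sup>2) ^ CARD('m))"
  unfolding discrete_resolvent_power_def
  using assms(2) by (intro diagonal_operator.has_L2_trace_resolvent_power[OF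
    diagonal_operator_combinatorial_laplacian[OF assms(1)]] has_sum_finiteI finite_discrete_torus) auto

lemma discrete_resolvent_trace_eq:
  assumes "n \<ge> 1" "z > 0"
  shows "discrete_resolvent_trace TYPE('m::finite) n z =
    (\<Sum>k\<in>discrete_torus n. 1 / (discrete_eigenvalue n (k :: int ^ 'm) + z\<^sup>2) ^ CARD('m))"
  unfolding discrete_resolvent_trace_def
  by (rule L2_basis.L2_trace_eqI[OF diagonal_operator.axioms(1)[OF
    diagonal_operator_combinatorial_laplacian[OF assms(1)]] has_L2_trace_discrete_resolvent_power[OF assms]])

section \<open>Dominated families of series\<close>

lemma norm_infsum_dominated:
  fixes f h :: "'i \<Rightarrow> real"
  assumes h: "h summable_on I" and le: "\<And>i. i \<in> I \<Longrightarrow> \<bar>f i\<bar> \<le> h i"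
  shows "f summable_on I" "\<bar>infsum f I\<bar> \<le> infsum h I"
proof -
  have abs: "(\<lambda>i. norm (f i)) summable_on I"
    using le by (intro summable_on_comparison_test[OF h]) auto
  then show "f summable_on I" by (rule abs_summable_summable)
  have "norm (infsum f I) \<le> infsum (\<lambda>i. norm (f i)) I"
    by (rule norm_infsum_bound[OF abs])
  also have "\<dots> \<le> infsum h I"
    using le by (intro infsum_mono abs h) auto
  finally show "\<bar>infsum f I\<bar> \<le> infsum h I" by simp
qed

text \<open>Dominated convergence for unordered sums along an arbitrary filter: it is applied at
  infinity in n and, for difference quotients, at 0.\<close>

lemma tendsto_infsum_dominated:
  fixes f :: "'n \<Rightarrow> 'i \<Rightarrow> real"
  assumes lim: "\<And>i. i \<in> I \<Longrightarrow> ((\<lambda>n. f n i) \<longlongrightarrow> g i) F"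
    and bound: "\<forall>\<^sub>F n in F. \<forall>i\<in>I. \<bar>f n i\<bar> \<le> h i"
    and h: "h summable_on I"
  shows "((\<lambda>n. infsum (f n) I) \<longlongrightarrow> infsum g I) F"
proof (cases "F = bot")
  case False
  have g: "\<bar>g i\<bar> \<le> h i" if "i \<in> I" for i
  proof (rule tendsto_upperbound[OF tendsto_rabs[OF lim[OF that]] _ False])
    show "\<forall>\<^sub>F n in F. \<bar>f n i\<bar> \<le> h i"
      using bound by eventually_elim (use that in auto)
  qed
  show ?thesis
  proof (rule tendstoI)
    fix e :: real assume e: "0 < e"
    \<comment> \<open>Error budget: the head over \<open>J\<close> will contribute less than e / 2,
      each of the two tails at most e / 8.\<close>
    obtain J where J: "finite J" "J \<subseteq> I" "dist (sum h J) (infsum h I) \<le> e / 8"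
      using infsum_finite_approximation[OF h, of "e / 8"] e by auto
    have hJ: "h summable_on (I - J)" using h by (rule summable_on_subset_banach) auto
    have split: "infsum \<psi> I = sum \<psi> J + infsum \<psi> (I - J)" if "\<psi> summable_on I" for \<psi> :: "'i \<Rightarrow> real"
    proof -
      have "infsum \<psi> (J \<union> (I - J)) = infsum \<psi> J + infsum \<psi> (I - J)"
        using J that by (intro infsum_Un_disjoint) (auto intro: summable_on_subset_banach)
      with J show ?thesis by (simp add: Un_absorb1)
    qed
    have tail: "infsum h (I - J) \<le> e / 8"
      using J(3) split[OF h] by (auto simp: dist_real_def)
    have "((\<lambda>n. \<Sum>i\<in>J. \<bar>f n i - g i\<bar>) \<longlongrightarrow> (\<Sum>i\<in>J. \<bar>g i - g i\<bar>)) F"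
      using J by (intro tendsto_intros lim) auto
    then have "\<forall>\<^sub>F n in F. (\<Sum>i\<in>J. \<bar>f n i - g i\<bar>) < e / 2"
      using e by (intro order_tendstoD) auto
    then show "\<forall>\<^sub>F n in F. dist (infsum (f n) I) (infsum g I) < e"
      using bound
    proof eventually_elim
      case (elim n)
      have fs: "f n summable_on I" and gs: "g summable_on I"
        using elim g by (auto intro: norm_infsum_dominated(1)[OF h])
      have "\<bar>infsum (f n) (I - J)\<bar> \<le> infsum h (I - J)" "\<bar>infsum g (I - J)\<bar> \<le> infsum h (I - J)"
        using elim g by (auto intro!: norm_infsum_dominated(2)[OF hJ])
      moreover have "\<bar>sum (f n) J - sum g J\<bar> \<le> (\<Sum>i\<in>J. \<bar>f n i - g i\<bar>)"
        unfolding sum_subtractf[symmetric] by (rule sum_abs)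
      ultimately show ?case
        using elim(1) tail e unfolding dist_real_def split[OF fs] split[OF gs] by linarith
    qed
  qed
qed simp

text \<open>By the mean value inequality the bound on the derivatives also bounds the difference
  quotients, so these converge under a common majorant.\<close>

lemma has_real_derivative_infsum:
  fixes f f' :: "'i \<Rightarrow> real \<Rightarrow> real"
  assumes r: "0 < r"
    and deriv: "\<And>i x. i \<in> I \<Longrightarrow> \<bar>x - w\<bar> < r \<Longrightarrow> (f i has_real_derivative f' i x) (at x)"
    and bound: "\<And>i x. i \<in> I \<Longrightarrow> \<bar>x - w\<bar> < r \<Longrightarrow> \<bar>f' i x\<bar> \<le> h i"
    and h: "h summable_on I"
    and summ: "\<And>x. \<bar>x - w\<bar> < r \<Longrightarrow> (\<lambda>i. f i x) summable_on I"
  shows "((\<lambda>x. \<Sum>\<^sub>\<infinity>i\<in>I. f i x) has_real_derivative (\<Sum>\<^sub>\<infinity>i\<in>I. f' i w)) (at w)"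
proof -
  have near: "\<forall>\<^sub>F t in at (0::real). \<bar>t\<bar> < r \<and> t \<noteq> 0"
    using r by (auto simp: eventually_at intro!: exI[of _ r])
  have "((\<lambda>t. \<Sum>\<^sub>\<infinity>i\<in>I. (f i (w + t) - f i w) / t) \<longlongrightarrow> (\<Sum>\<^sub>\<infinity>i\<in>I. f' i w)) (at 0)"
  proof (rule tendsto_infsum_dominated[OF _ _ h])
    show "((\<lambda>t. (f i (w + t) - f i w) / t) \<longlongrightarrow> f' i w) (at 0)" if "i \<in> I" for i
      using deriv[OF that, of w] r by (simp add: DERIV_def)
    show "\<forall>\<^sub>F t in at 0. \<forall>i\<in>I. \<bar>(f i (w + t) - f i w) / t\<bar> \<le> h i"
      using near
    proof (eventually_elim, intro ballI)
      fix t i assume t: "\<bar>t\<bar> < r \<and> t \<noteq> 0" and i: "i \<in> I"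
      have "norm (f i (w + t) - f i w) \<le> h i * norm (w + t - w)"
      proof (rule field_differentiable_bound[where S = "ball w r"])
        show "(f i has_field_derivative f' i x) (at x within ball w r)" if "x \<in> ball w r" for x
          using deriv[OF i, of x] that
          by (auto simp: dist_real_def abs_minus_commute intro: has_field_derivative_at_within)
        show "norm (f' i x) \<le> h i" if "x \<in> ball w r" for x
          using bound[OF i, of x] that by (auto simp: dist_real_def abs_minus_commute)
      qed (use t r in \<open>auto simp: dist_real_def\<close>)
      then show "\<bar>(f i (w + t) - f i w) / t\<bar> \<le> h i"
        using t by (simp add: pos_divide_le_eq)
    qed
  qed
  moreover have "\<forall>\<^sub>F t in at 0. (\<Sum>\<^sub>\<infinity>i\<in>I. (f i (w + t) - f i w) / t)
      = ((\<Sum>\<^sub>\<infinity>i\<in>I. f i (w + t)) - (\<Sum>\<^sub>\<infinity>i\<in>I. f i w)) / t"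
    using near
  proof eventually_elim
    case (elim t)
    have s: "(\<lambda>i. f i (w + t)) summable_on I" "(\<lambda>i. f i w) summable_on I"
      using summ[of "w + t"] summ[of w] elim r by auto
    have "((\<lambda>i. (f i (w + t) + - f i w) / t) has_sum
        ((\<Sum>\<^sub>\<infinity>i\<in>I. f i (w + t)) + - (\<Sum>\<^sub>\<infinity>i\<in>I. f i w)) / t) I"
      by (intro has_sum_divide_const has_sum_add has_sum_uminusI has_sum_infsum s)
    then show ?case by (simp add: infsumI)
  qed
  ultimately show ?thesis
    unfolding DERIV_def using tendsto_cong by force
qed

section \<open>Inverse power sums\<close>

definition inverse_power_sum :: "'i set \<Rightarrow> ('i \<Rightarrow> real) \<Rightarrow> nat \<Rightarrow> real \<Rightarrow> real" where
  "inverse_power_sum I ev p w = (\<Sum>\<^sub>\<infinity>i\<in>I. 1 / (ev i + w) ^ p)"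

text \<open>Reduces every exponent p above m to m itself, the one exponent for which a majorant is
  constructed.\<close>

lemma inverse_power_le:
  fixes x :: real
  assumes "0 < w" "w \<le> x" "m \<le> p"
  shows "1 / x ^ p \<le> (1 / w) ^ (p - m) * (1 / x ^ m)"
proof -
  have "1 / x ^ p = (1 / x) ^ (p - m) * (1 / x ^ m)"
    using assms by (simp add: power_one_over power_add[symmetric] flip: power_add)
  also have "\<dots> \<le> (1 / w) ^ (p - m) * (1 / x ^ m)"
    using assms by (intro mult_right_mono power_mono divide_left_mono) auto
  finally show ?thesis .
qed

lemma inverse_power_sum_summable:
  fixes ev :: "'i \<Rightarrow> real"
  assumes nonneg: "\<And>i. i \<in> I \<Longrightarrow> 0 \<le> ev i"
    and summ: "(\<lambda>i. 1 / (ev i + w) ^ m) summable_on I" and "0 < w" "m \<le> p"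
  shows "(\<lambda>i. 1 / (ev i + w) ^ p) summable_on I"
  using assms
  by (intro summable_on_comparison_test[OF summable_on_cmult_right[OF summ, of "(1 / w) ^ (p - m)"]]
    inverse_power_le) auto

lemma has_derivative_inverse_power_sum:
  assumes nonneg: "\<And>i. i \<in> I \<Longrightarrow> 0 \<le> ev i"
    and summ: "\<And>w. 0 < w \<Longrightarrow> (\<lambda>i. 1 / (ev i + w) ^ m) summable_on I"
    and w: "0 < w" and p: "m \<le> p"
  shows "(inverse_power_sum I ev p has_real_derivative - real p * inverse_power_sum I ev (Suc p) w) (at w)"
proof -
  have "((\<lambda>x. \<Sum>\<^sub>\<infinity>i\<in>I. 1 / (ev i + x) ^ p) has_real_derivative
      (\<Sum>\<^sub>\<infinity>i\<in>I. - real p * (1 / (ev i + w) ^ Suc p))) (at w)"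
  \<comment> \<open>The radius w / 2 keeps x above w / 2; as the terms decrease in x, their values
    at w / 2 dominate on the whole interval.\<close>
  proof (rule has_real_derivative_infsum[where r = "w / 2" and
        h = "\<lambda>i. real p * (1 / (ev i + w / 2) ^ Suc p)"])
    fix i x assume i: "i \<in> I" and "\<bar>x - w\<bar> < w / 2"
    then have x: "w / 2 < x" by (simp add: abs_if split: if_splits)
    have pos: "0 < ev i + x" "0 < ev i + w / 2" using nonneg[OF i] w x by linarith+
    show "((\<lambda>x. 1 / (ev i + x) ^ p) has_real_derivative - real p * (1 / (ev i + x) ^ Suc p)) (at x)"
    proof (cases p)
      case (Suc q)
      define y where "y = ev i + x"
      have "0 < y" using pos by (simp add: y_def)
      have "((\<lambda>x. (ev i + x) ^ p) has_real_derivative real p * y ^ q) (at x)"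
        unfolding y_def Suc by (rule derivative_eq_intros refl)+ simp
      then have "((\<lambda>x. inverse ((ev i + x) ^ p)) has_real_derivative
          - (inverse (y ^ p) * (real p * y ^ q) * inverse (y ^ p))) (at x)"
        unfolding y_def by (rule DERIV_inverse') (use pos in simp)
      also have "inverse (y ^ p) * (real p * y ^ q) * inverse (y ^ p) = real p * (1 / y ^ Suc p)"
        using \<open>0 < y\<close> Suc by (simp add: field_simps)
      finally show ?thesis by (simp add: y_def inverse_eq_divide)
    qed auto
    have "1 / (ev i + x) ^ Suc p \<le> 1 / (ev i + w / 2) ^ Suc p"
      using pos x by (intro divide_left_mono power_mono mult_pos_pos zero_less_power) auto
    then have "real p * (1 / (ev i + x) ^ Suc p) \<le> real p * (1 / (ev i + w / 2) ^ Suc p)"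
      by (intro mult_left_mono) auto
    then show "\<bar>- real p * (1 / (ev i + x) ^ Suc p)\<bar> \<le> real p * (1 / (ev i + w / 2) ^ Suc p)"
      using pos(1) by (simp add: abs_mult)
  next
    fix x assume "\<bar>x - w\<bar> < w / 2"
    then have "0 < x" using w by (simp add: abs_if split: if_splits)
    then show "(\<lambda>i. 1 / (ev i + x) ^ p) summable_on I"
      using p by (intro inverse_power_sum_summable[OF nonneg summ]) auto
  next
    show "(\<lambda>i. real p * (1 / (ev i + w / 2) ^ Suc p)) summable_on I"
      using w p by (intro summable_on_cmult_right inverse_power_sum_summable[OF nonneg summ, where p = "Suc p"]) auto
  qed (use w in auto)
  then show ?thesis
    unfolding inverse_power_sum_def[abs_def] infsum_cmult_right' .
qed

section \<open>Higher derivatives after the substitution of a square\<close>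

text \<open>The coefficient polynomials of H^(j)(z^2) in the k-th derivative of H(z^2). The
  recursion is the product rule; \<open>[:0, 2:]\<close> is the inner derivative 2 z.\<close>

fun square_chain_coeff :: "nat \<Rightarrow> nat \<Rightarrow> real poly" where
  "square_chain_coeff 0 j = (if j = 0 then 1 else 0)"
| "square_chain_coeff (Suc k) 0 = pderiv (square_chain_coeff k 0)"
| "square_chain_coeff (Suc k) (Suc j) =
     pderiv (square_chain_coeff k (Suc j)) + [:0, 2:] * square_chain_coeff k j"

lemma square_chain_coeff_eq_0: "k < j \<Longrightarrow> square_chain_coeff k j = 0"
  by (induction k j rule: square_chain_coeff.induct) auto

text \<open>The coefficients do not depend on \<open>H\<close>. Limits of z-derivatives thereby
  reduce to limits of finitely many derivatives in w = z^2.\<close>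

lemma higher_deriv_square_comp:
  assumes H: "\<And>j w. 0 < w \<Longrightarrow> (H j has_real_derivative H (Suc j) w) (at w)"
    and G: "\<And>z. 0 < z \<Longrightarrow> G z = H 0 (z\<^sup>2)" and z: "0 < (z::real)"
  shows "(deriv ^^ k) G z = (\<Sum>j\<le>k. poly (square_chain_coeff k j) z * H j (z\<^sup>2))"
  using z
proof (induction k arbitrary: z)
  case 0
  then show ?case by (simp add: G)
next
  case (Suc k)
  let ?C = square_chain_coeff
  have "((\<lambda>z. \<Sum>j\<le>k. poly (?C k j) z * H j (z\<^sup>2)) has_real_derivative
      (\<Sum>j\<le>k. poly (pderiv (?C k j)) z * H j (z\<^sup>2) + H (Suc j) (z\<^sup>2) * (2 * z) * poly (?C k j) z)) (at z)"
  proof (intro DERIV_sum DERIV_mult poly_DERIV)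
    show "((\<lambda>z. H j (z\<^sup>2)) has_real_derivative H (Suc j) (z\<^sup>2) * (2 * z)) (at z)" for j
      by (rule DERIV_chain2[OF H]) (use Suc.prems in \<open>auto intro!: derivative_eq_intros\<close>)
  qed
  \<comment> \<open>Differentiating the formula for k needs it near z and not only at z; the
    positive half-line is open.\<close>
  moreover have "\<forall>\<^sub>F x in nhds z. (deriv ^^ k) G x = (\<Sum>j\<le>k. poly (?C k j) x * H j (x\<^sup>2))"
    using eventually_nhds_in_open[of "{0<..}" z] Suc.prems Suc.IH
    by (auto elim!: eventually_mono)
  ultimately have "(deriv ^^ Suc k) G z =
      (\<Sum>j\<le>k. poly (pderiv (?C k j)) z * H j (z\<^sup>2) + H (Suc j) (z\<^sup>2) * (2 * z) * poly (?C k j) z)"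
    by (simp add: deriv_cong_ev DERIV_imp_deriv)
  \<comment> \<open>The added term j = Suc k has coefficient zero; it aligns the first sum with the
    index shift of the second.\<close>
  also have "\<dots> = (\<Sum>j\<le>Suc k. poly (pderiv (?C k j)) z * H j (z\<^sup>2))
      + (\<Sum>j\<le>k. poly ([:0, 2:] * ?C k j) z * H (Suc j) (z\<^sup>2))"
    by (simp add: sum.distrib square_chain_coeff_eq_0 mult_ac)
  also have "\<dots> = (\<Sum>j\<le>Suc k. poly (?C (Suc k) j) z * H j (z\<^sup>2))"
    unfolding sum.atMost_Suc_shift by (simp add: sum.distrib distrib_right)
  finally show ?case .
qed

lemma smooth_on_open_square_comp:
  assumes H: "\<And>j w. 0 < w \<Longrightarrow> (H j has_real_derivative H (Suc j) w) (at w)"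
    and G: "\<And>z. 0 < z \<Longrightarrow> G z = H 0 (z\<^sup>2)"
  shows "smooth_on_open {0<..} G"
  unfolding smooth_on_open_def
proof
  fix k
  have "(\<lambda>z. \<Sum>j\<le>k. poly (square_chain_coeff k j) z * H j (z\<^sup>2)) differentiable_on {0<..}"
    unfolding differentiable_on_def
  proof
    fix z :: real assume z: "z \<in> {0<..}"
    have "((\<lambda>z. H j (z\<^sup>2)) has_real_derivative H (Suc j) (z\<^sup>2) * (2 * z)) (at z)" for j
      by (rule DERIV_chain2[OF H]) (use z in \<open>auto intro!: derivative_eq_intros\<close>)
    then have "(\<lambda>z. H j (z\<^sup>2)) differentiable at z" for j
      by (auto simp: real_differentiable_def)
    moreover have "poly (square_chain_coeff k j) differentiable at z" for j
      by (auto simp: real_differentiable_def intro: poly_DERIV)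
    ultimately show "(\<lambda>z. \<Sum>j\<le>k. poly (square_chain_coeff k j) z * H j (z\<^sup>2)) differentiable at z within {0<..}"
      by (intro differentiable_sum differentiable_mult ballI) (auto intro: differentiable_at_withinI)
  qed
  then show "(deriv ^^ k) G differentiable_on {0<..}"
    unfolding differentiable_on_def
    by (auto simp: higher_deriv_square_comp[OF H G] intro: differentiable_transform_within[OF _ zero_less_one])
qed

section \<open>Lattice sums\<close>

lemma summable_on_int_quadratic:
  fixes a b :: real
  assumes a: "0 < a" and b: "0 < b"
  shows "(\<lambda>k::int. 1 / (a * (real_of_int k)\<^sup>2 + b)) summable_on UNIV"
proof -
  define f where "f k = 1 / (a * (real_of_int k)\<^sup>2 + b)" for k
  have "summable (\<lambda>n::nat. 1 / (a * (real n)\<^sup>2 + b))"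
  proof (rule summable_comparison_test'[where N = 1])
    show "summable (\<lambda>n::nat. 1 / a * (1 / (real n)\<^sup>2))"
      using inverse_power_summable[of 2, where 'a = real] by (intro summable_mult) (simp add: inverse_eq_divide)
    fix n :: nat assume n: "1 \<le> n"
    have "1 / (a * (real n)\<^sup>2 + b) \<le> 1 / (a * (real n)\<^sup>2)"
      using a b n by (intro divide_left_mono mult_pos_pos add_pos_pos) auto
    then show "norm (1 / (a * (real n)\<^sup>2 + b)) \<le> 1 / a * (1 / (real n)\<^sup>2)"
      using a b by simp
  qed
  then have nat: "(\<lambda>n::nat. 1 / (a * (real n)\<^sup>2 + b)) summable_on UNIV"
    using a b by (intro summable_nonneg_imp_summable_on) auto
  have "f summable_on range int"
    using nat by (subst summable_on_reindex) (auto simp: o_def f_def)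
  moreover have "f summable_on range (\<lambda>n. - int n)"
    using nat by (subst summable_on_reindex) (auto simp: o_def f_def inj_on_def)
  ultimately have "f summable_on (range int \<union> range (\<lambda>n. - int n))"
    by (rule summable_on_union)
  also have "range int \<union> range (\<lambda>n. - int n) = UNIV"
    by (auto intro: int_cases2)
  finally show ?thesis by (simp add: f_def[abs_def])
qed

text \<open>A finite set of lattice points lies in a box, over which the sum of products factorises.\<close>

lemma summable_on_lattice_prod:
  fixes g :: "int \<Rightarrow> real"
  assumes g: "g summable_on UNIV" and nonneg: "\<And>k. 0 \<le> g k"
  shows "(\<lambda>k :: int ^ 'm::finite. \<Prod>i\<in>UNIV. g (k $ i)) summable_on UNIV"
proof (rule nonneg_bdd_above_summable_on)
  show "bdd_above (sum (\<lambda>k :: int ^ 'm. \<Prod>i\<in>UNIV. g (k $ i)) ` {F. F \<subseteq> UNIV \<and> finite F})"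
  proof (rule bdd_aboveI2)
    fix F :: "(int ^ 'm) set" assume "F \<in> {F. F \<subseteq> UNIV \<and> finite F}"
    then have F: "finite F" by simp
    define B where "B i = (\<lambda>k. k $ i) ` F" for i
    have B: "finite (B i)" for i using F by (simp add: B_def)
    have "(\<Sum>k\<in>F. \<Prod>i\<in>UNIV. g (k $ i)) = (\<Sum>f\<in>vec_nth ` F. \<Prod>i\<in>UNIV. g (f i))"
      by (subst sum.reindex) (auto simp: inj_on_def vec_nth_inject)
    also have "\<dots> \<le> (\<Sum>f\<in>PiE UNIV B. \<Prod>i\<in>UNIV. g (f i))"
      using B nonneg by (intro sum_mono2 finite_PiE prod_nonneg) (auto simp: B_def)
    also have "\<dots> = (\<Prod>i\<in>UNIV. \<Sum>k\<in>B i. g k)"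
      by (rule prod_sum_PiE[symmetric]) (auto simp: B)
    also have "\<dots> \<le> (\<Prod>i\<in>(UNIV :: 'm set). infsum g UNIV)"
      using B g nonneg by (intro prod_mono conjI sum_nonneg finite_sum_le_infsum) auto
    finally show "(\<Sum>k\<in>F. \<Prod>i\<in>UNIV. g (k $ i)) \<le> (\<Prod>i\<in>(UNIV :: 'm set). infsum g UNIV)" .
  qed
qed (use nonneg in \<open>auto intro: prod_nonneg\<close>)

lemma prod_le_sum_power:
  fixes x :: "'m::finite \<Rightarrow> real"
  assumes "\<And>i. 0 \<le> x i"
  shows "(\<Prod>i\<in>UNIV. x i) \<le> (\<Sum>i\<in>UNIV. x i) ^ CARD('m)"
proof -
  have "(\<Prod>i\<in>UNIV. x i) \<le> (\<Prod>i\<in>(UNIV :: 'm set). \<Sum>i\<in>UNIV. x i)"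
    using assms by (intro prod_mono) (auto intro: member_le_sum)
  then show ?thesis by simp
qed

text \<open>The constant w is shared equally among the m factors: each denominator stays positive,
  and together they add up to a times the squared length of k, plus w. The values used are a = 1 for
  the torus and a = 1/4 for the discrete tori.\<close>

definition lattice_bound :: "real \<Rightarrow> real \<Rightarrow> int ^ 'm::finite \<Rightarrow> real" where
  "lattice_bound a w k = (\<Prod>i\<in>UNIV. 1 / (a * (real_of_int (k $ i))\<^sup>2 + w / CARD('m)))"

lemma lattice_bound_nonneg: "0 \<le> a \<Longrightarrow> 0 < w \<Longrightarrow> 0 \<le> lattice_bound a w k"
  by (auto simp: lattice_bound_def intro!: prod_nonneg)

lemma summable_lattice_bound:
  assumes "0 < a" "0 < w"
  shows "(lattice_bound a w :: int ^ 'm::finite \<Rightarrow> real) summable_on UNIV"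
proof -
  have "0 < w / CARD('m)" using assms by simp
  with assms show ?thesis
    unfolding lattice_bound_def[abs_def]
    by (intro summable_on_lattice_prod summable_on_int_quadratic) auto
qed

text \<open>The exponent \<open>CARD('m)\<close> is what makes the m-fold product of convergent one-dimensional series
  a majorant.\<close>

lemma inverse_power_le_lattice_bound:
  fixes k :: "int ^ 'm::finite"
  assumes a: "0 < a" and w: "0 < w" and ev: "(\<Sum>i\<in>UNIV. a * (real_of_int (k $ i))\<^sup>2) \<le> e"
  shows "1 / (e + w) ^ CARD('m) \<le> lattice_bound a w k"
proof -
  let ?x = "\<lambda>i. a * (real_of_int (k $ i))\<^sup>2 + w / CARD('m)"
  have x: "0 < ?x i" for i
    using a w by (intro add_nonneg_pos) auto
  have "(\<Prod>i\<in>UNIV. ?x i) \<le> (\<Sum>i\<in>UNIV. ?x i) ^ CARD('m)"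
    using x by (intro prod_le_sum_power less_imp_le)
  also have "(\<Sum>i\<in>UNIV. ?x i) = (\<Sum>i\<in>UNIV. a * (real_of_int (k $ i))\<^sup>2) + w"
    by (simp add: sum.distrib)
  also have "\<dots> ^ CARD('m) \<le> (e + w) ^ CARD('m)"
    using ev w a by (intro power_mono add_nonneg_nonneg sum_nonneg) auto
  finally have "1 / (e + w) ^ CARD('m) \<le> 1 / (\<Prod>i\<in>UNIV. ?x i)"
    using x by (intro divide_left_mono mult_pos_pos prod_pos)
      (auto intro!: zero_less_power add_nonneg_pos w order_trans[OF _ ev] sum_nonneg mult_nonneg_nonneg less_imp_le[OF a])
  then show ?thesis by (simp add: lattice_bound_def prod_dividef)
qed

definition torus_eigenvalue :: "int ^ 'm::finite \<Rightarrow> real" where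
  "torus_eigenvalue k = (\<Sum>i\<in>UNIV. (real_of_int (k $ i))\<^sup>2)"

lemma torus_eigenvalue_nonneg: "0 \<le> torus_eigenvalue k"
  by (simp add: torus_eigenvalue_def sum_nonneg)

lemma discrete_eigenvalue_nonneg: "0 \<le> discrete_eigenvalue n k"
  by (auto simp: discrete_eigenvalue_def intro!: divide_nonneg_nonneg mult_nonneg_nonneg sum_nonneg)

lemma torus_eigenvalue_summable:
  assumes "0 < w"
  shows "(\<lambda>k :: int ^ 'm::finite. 1 / (torus_eigenvalue k + w) ^ CARD('m)) summable_on UNIV"
  by (rule summable_on_comparison_test[OF summable_lattice_bound[of 1 w]])
    (use assms torus_eigenvalue_nonneg in \<open>auto simp: torus_eigenvalue_def add_nonneg_nonneg sum_nonneg
      intro!: inverse_power_le_lattice_bound\<close>)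

section \<open>Convergence of the discrete sums\<close>

text \<open>In sin x = 2 sin (x/2) cos (x/2) the half angle is at most pi/4, where the cosine is at
  least sqrt 2 / 2. Hence, by the mean value theorem, sin (x/2) is at least sqrt 2 / 2 times x/2,
  and the two factors sqrt 2 / 2 cancel the 2.\<close>

lemma half_le_sin:
  assumes "0 \<le> x" "x \<le> pi / 2"
  shows "x / 2 \<le> sin x"
proof -
  have y: "0 \<le> x / 2" "x / 2 \<le> pi / 4" using assms by auto
  have cos_ge: "sqrt 2 / 2 \<le> cos t" if "0 \<le> t" "t \<le> pi / 4" for t
    using cos_monotone_0_pi_le[of t "pi / 4"] that by (simp add: cos_45)
  have sin_ge: "sqrt 2 / 2 * (x / 2) \<le> sin (x / 2)"
  proof (cases "x = 0")
    case False
    obtain t where t: "0 < t" "t < x / 2" "sin (x / 2) - sin 0 = (x / 2 - 0) * cos t"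
      using MVT2[of 0 "x / 2" sin cos] False y by auto
    have "sqrt 2 / 2 * (x / 2) \<le> cos t * (x / 2)"
      using t y by (intro mult_right_mono cos_ge) auto
    with t(3) show ?thesis by (simp add: mult.commute)
  qed simp
  have "x / 2 = 2 * ((sqrt 2 / 2 * (x / 2)) * (sqrt 2 / 2))" by simp
  also have "\<dots> \<le> 2 * (sin (x / 2) * cos (x / 2))"
    using y sin_ge cos_ge[OF y] by (intro mult_left_mono mult_mono) (auto intro: sin_ge_zero)
  also have "\<dots> = sin x" using sin_double[of "x / 2"] by simp
  finally show ?thesis .
qed

text \<open>Strict on the left only, so that for even n the class of n / 2 has one representative
  and not two.\<close>

definition centred_residues :: "nat \<Rightarrow> (int ^ 'm::finite) set" where
  "centred_residues n = {k. \<forall>i. - int n < 2 * k $ i \<and> 2 * k $ i \<le> int n}"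

text \<open>For centred k the angle pi k / n lies within pi/2 of 0, the range of
  \<open>half_le_sin\<close>. The constant 1/4 does not depend on n.\<close>

lemma discrete_eigenvalue_ge:
  assumes n: "n \<ge> 1" and k: "k \<in> centred_residues n"
  shows "(\<Sum>i\<in>UNIV. 1 / 4 * (real_of_int (k $ i))\<^sup>2) \<le> discrete_eigenvalue n k"
proof -
  have "1 / 4 * (real_of_int (k $ i))\<^sup>2 \<le> (real n)\<^sup>2 / pi\<^sup>2 * (sin (pi * of_int (k $ i) / n))\<^sup>2" for i
  proof -
    define x where "x = pi * \<bar>of_int (k $ i)\<bar> / n"
    have "- int n \<le> 2 * k $ i" "2 * k $ i \<le> int n"
      using k by (auto simp: centred_residues_def less_imp_le)
    then have "2 * \<bar>k $ i\<bar> \<le> int n" by auto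
    then have "2 * \<bar>real_of_int (k $ i)\<bar> \<le> real n"
      by linarith
    then have x: "0 \<le> x" "x \<le> pi / 2"
      using n by (auto simp: x_def field_simps)
    have "(x / 2)\<^sup>2 \<le> (sin x)\<^sup>2"
      using half_le_sin[OF x] x by (intro power_mono) auto
    moreover have "(sin x)\<^sup>2 = (sin (pi * of_int (k $ i) / n))\<^sup>2"
      by (simp add: x_def abs_if)
    ultimately have "(real n)\<^sup>2 / pi\<^sup>2 * (x / 2)\<^sup>2 \<le> (real n)\<^sup>2 / pi\<^sup>2 * (sin (pi * of_int (k $ i) / n))\<^sup>2"
      by (intro mult_left_mono) auto
    moreover have "(real n)\<^sup>2 / pi\<^sup>2 * (x / 2)\<^sup>2 = 1 / 4 * (real_of_int (k $ i))\<^sup>2"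
      using n by (simp add: x_def power_divide power_mult_distrib)
    ultimately show ?thesis by (simp only:)
  qed
  then show ?thesis
    unfolding discrete_eigenvalue_def sum_distrib_left by (intro sum_mono)
qed

text \<open>With c = pi k, the quantity n sin (c / n) is the difference quotient of sin (c x) at 0
  with increment 1 / n.\<close>

lemma discrete_eigenvalue_tendsto:
  "(\<lambda>n. discrete_eigenvalue n k) \<longlonglongrightarrow> torus_eigenvalue k"
proof -
  have "(\<lambda>n. (real n / pi * sin (pi * of_int (k $ i) / n))\<^sup>2) \<longlonglongrightarrow> (real_of_int (k $ i))\<^sup>2" for i
  proof -
    define c where "c = pi * real_of_int (k $ i)"
    have "((\<lambda>x. sin (c * x)) has_real_derivative c) (at 0)"
      by (auto intro!: derivative_eq_intros)
    then have "((\<lambda>h. sin (c * h) / h) \<longlongrightarrow> c) (at 0)"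
      by (simp add: DERIV_def)
    moreover have "filterlim (\<lambda>n. inverse (real n)) (at 0) sequentially"
      by (rule filterlim_atI[OF tendsto_inverse_0_at_top[OF filterlim_real_sequentially]])
        (auto intro: eventually_sequentiallyI[of 1])
    ultimately have "(\<lambda>n. sin (c * inverse (real n)) / inverse (real n)) \<longlonglongrightarrow> c"
      by (rule filterlim_compose)
    then have "(\<lambda>n. 1 / pi * (sin (c * inverse (real n)) / inverse (real n))) \<longlonglongrightarrow> 1 / pi * c"
      by (intro tendsto_intros)
    then have "(\<lambda>n. real n / pi * sin (pi * of_int (k $ i) / n)) \<longlonglongrightarrow> real_of_int (k $ i)"
      by (simp add: c_def field_simps)
    then show ?thesis by (intro tendsto_intros)
  qed
  then have "(\<lambda>n. \<Sum>i\<in>UNIV. (real n / pi * sin (pi * of_int (k $ i) / n))\<^sup>2) \<longlonglongrightarrow> torus_eigenvalue k"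
    unfolding torus_eigenvalue_def by (intro tendsto_sum)
  moreover have "(\<Sum>i\<in>UNIV. (real n / pi * sin (pi * of_int (k $ i) / n))\<^sup>2) = discrete_eigenvalue n k" for n
    by (simp add: discrete_eigenvalue_def sum_distrib_left power_mult_distrib power_divide)
  ultimately show ?thesis by simp
qed

lemma eventually_centred_residues:
  "\<forall>\<^sub>F n in sequentially. (k :: int ^ 'm::finite) \<in> centred_residues n"
proof -
  have "\<forall>\<^sub>F n in sequentially. - int n < 2 * k $ i \<and> 2 * k $ i \<le> int n" for i
    using eventually_gt_at_top[of "nat \<bar>2 * k $ i\<bar>"] by eventually_elim linarith
  then show ?thesis
    unfolding centred_residues_def by (simp add: eventually_all_finite)
qed

text \<open>Subtracting n from a coordinate moves the angle by pi, which changes only the sign of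
  the sine; the eigenvalue contains its square.\<close>

lemma sum_discrete_torus_centred:
  assumes n: "n \<ge> 1"
  shows "(\<Sum>k\<in>discrete_torus n. h (discrete_eigenvalue n (k :: int ^ 'm::finite)) :: real)
    = (\<Sum>\<^sub>\<infinity>k\<in>centred_residues n. h (discrete_eigenvalue n (k :: int ^ 'm)))"
proof -
  define c :: "int ^ 'm \<Rightarrow> int ^ 'm" where
    "c k = (\<chi> i. if 2 * k $ i \<le> int n then k $ i else k $ i - int n)" for k
  define d :: "int ^ 'm \<Rightarrow> int ^ 'm" where
    "d k = (\<chi> i. if 0 \<le> k $ i then k $ i else k $ i + int n)" for k
  have ev: "discrete_eigenvalue n (c k) = discrete_eigenvalue n k" for k
  proof -
    have "sin (pi * of_int (k $ i - int n) / n) = - sin (pi * of_int (k $ i) / n)" for i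
    proof -
      have "pi * of_int (k $ i - int n) / n = pi * of_int (k $ i) / n - pi"
        using n by (simp add: field_simps)
      then show ?thesis by (simp add: sin_diff)
    qed
    then show ?thesis
      unfolding discrete_eigenvalue_def by (auto simp: c_def intro!: sum.cong arg_cong2[where f = times])
  qed
  have "bij_betw c (discrete_torus n) (centred_residues n)"
  proof (rule bij_betwI[where g = d])
    show "c \<in> discrete_torus n \<rightarrow> centred_residues n"
    proof
      fix k :: "int ^ 'm" assume "k \<in> discrete_torus n"
      then have k: "0 \<le> k $ i" "k $ i < int n" for i
        by (auto simp: discrete_torus_def)
      have "- int n < 2 * c k $ i \<and> 2 * c k $ i \<le> int n" for i
        unfolding c_def using n k[of i] by simp
      then show "c k \<in> centred_residues n" by (simp add: centred_residues_def)
    qed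
    show "d \<in> centred_residues n \<rightarrow> discrete_torus n"
    proof
      fix k :: "int ^ 'm" assume "k \<in> centred_residues n"
      then have k: "- int n < 2 * k $ i" "2 * k $ i \<le> int n" for i
        by (auto simp: centred_residues_def)
      have "d k $ i \<in> {0..<int n}" for i
        unfolding d_def using n k[of i] by auto
      then show "d k \<in> discrete_torus n" by (simp add: discrete_torus_def)
    qed
    show "d (c k) = k" if "k \<in> discrete_torus n" for k
    proof -
      have k: "0 \<le> k $ i" "k $ i < int n" for i
        using that by (auto simp: discrete_torus_def)
      have "d (c k) $ i = k $ i" for i
        unfolding c_def d_def using k[of i] by auto
      then show ?thesis by (simp add: vec_eq_iff)
    qed
    show "c (d k) = k" if "k \<in> centred_residues n" for k
    proof -
      have k: "- int n < 2 * k $ i" "2 * k $ i \<le> int n" for i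
        using that by (auto simp: centred_residues_def)
      have "c (d k) $ i = k $ i" for i
        unfolding c_def d_def using k[of i] by auto
      then show ?thesis by (simp add: vec_eq_iff)
    qed
  qed
  then have "(\<Sum>\<^sub>\<infinity>k\<in>discrete_torus n. h (discrete_eigenvalue n (c k)))
      = (\<Sum>\<^sub>\<infinity>k\<in>centred_residues n. h (discrete_eigenvalue n (k :: int ^ 'm)))"
    by (rule infsum_reindex_bij_betw)
  then show ?thesis by (simp add: ev finite_discrete_torus)
qed

text \<open>The index set varies with n, so the summands are extended by zero from the centred
  residues to the whole lattice. Each fixed k is eventually centred, which gives the pointwise
  limit, and the bound on centred residues gives the majorant.\<close>

lemma inverse_power_sum_tendsto:
  assumes w: "0 < w" and p: "CARD('m::finite) \<le> p"
  shows "(\<lambda>n. inverse_power_sum (discrete_torus n) (discrete_eigenvalue n :: int ^ 'm \<Rightarrow> real) p w)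
    \<longlonglongrightarrow> inverse_power_sum UNIV (torus_eigenvalue :: int ^ 'm \<Rightarrow> real) p w"
proof -
  let ?f = "\<lambda>n k. if (k :: int ^ 'm) \<in> centred_residues n then 1 / (discrete_eigenvalue n k + w) ^ p else 0"
  have "(\<lambda>n. \<Sum>\<^sub>\<infinity>k. ?f n k) \<longlonglongrightarrow> (\<Sum>\<^sub>\<infinity>k. 1 / (torus_eigenvalue (k :: int ^ 'm) + w) ^ p)"
  proof (rule tendsto_infsum_dominated)
    fix k :: "int ^ 'm"
    have "(\<lambda>n. 1 / (discrete_eigenvalue n k + w) ^ p) \<longlonglongrightarrow> 1 / (torus_eigenvalue k + w) ^ p"
      using torus_eigenvalue_nonneg[of k] w by (intro tendsto_intros discrete_eigenvalue_tendsto) auto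
    then show "(\<lambda>n. ?f n k) \<longlonglongrightarrow> 1 / (torus_eigenvalue k + w) ^ p"
      by (rule Lim_transform_eventually)
        (rule eventually_mono[OF eventually_centred_residues[of k]], simp)
  next
    show "(\<lambda>k :: int ^ 'm. (1 / w) ^ (p - CARD('m)) * lattice_bound (1 / 4) w k) summable_on UNIV"
      using w by (intro summable_on_cmult_right summable_lattice_bound) auto
    show "\<forall>\<^sub>F n in sequentially. \<forall>k :: int ^ 'm \<in> UNIV.
        \<bar>?f n k\<bar> \<le> (1 / w) ^ (p - CARD('m)) * lattice_bound (1 / 4) w k"
      using eventually_ge_at_top[of 1]
    proof (eventually_elim, intro ballI)
      fix n :: nat and k :: "int ^ 'm" assume n: "1 \<le> n"
      let ?e = "discrete_eigenvalue n k"
      have nonneg: "0 \<le> (1 / w) ^ (p - CARD('m)) * lattice_bound (1 / 4) w k"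
        using w by (intro mult_nonneg_nonneg lattice_bound_nonneg) auto
      show "\<bar>?f n k\<bar> \<le> (1 / w) ^ (p - CARD('m)) * lattice_bound (1 / 4) w k"
      proof (cases "k \<in> centred_residues n")
        case True
        have e: "0 \<le> ?e" by (rule discrete_eigenvalue_nonneg)
        have "1 / (?e + w) ^ p \<le> (1 / w) ^ (p - CARD('m)) * (1 / (?e + w) ^ CARD('m))"
          using w e p by (intro inverse_power_le) auto
        also have "\<dots> \<le> (1 / w) ^ (p - CARD('m)) * lattice_bound (1 / 4) w k"
          using w discrete_eigenvalue_ge[OF n True]
          by (intro mult_left_mono inverse_power_le_lattice_bound) auto
        finally show ?thesis using True e w by simp
      qed (use nonneg in simp)
    qed
  qed
  moreover have "\<forall>\<^sub>F n in sequentially. (\<Sum>\<^sub>\<infinity>k. ?f n k) =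
      inverse_power_sum (discrete_torus n) (discrete_eigenvalue n :: int ^ 'm \<Rightarrow> real) p w"
    using eventually_ge_at_top[of 1]
  proof eventually_elim
    case (elim n)
    have "(\<Sum>\<^sub>\<infinity>k. ?f n k) = (\<Sum>\<^sub>\<infinity>k\<in>centred_residues n. 1 / (discrete_eigenvalue n (k :: int ^ 'm) + w) ^ p)"
      by (rule infsum_cong_neutral) auto
    then show ?case
      unfolding inverse_power_sum_def
      using sum_discrete_torus_centred[OF elim, of "\<lambda>e. 1 / (e + w) ^ p", where 'm = 'm]
      by (simp add: finite_discrete_torus)
  qed
  ultimately show ?thesis
    unfolding inverse_power_sum_def[of UNIV] by (rule Lim_transform_eventually)
qed

section \<open>Periodic functions on Euclidean space\<close>

text \<open>Phrased through \<open>torus_param\<close> rather than translations, so that lifts of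
  functions on the torus are periodic by construction and closure properties are immediate.\<close>

definition torus_periodic :: "(real ^ 'm::finite \<Rightarrow> real) \<Rightarrow> bool" where
  "torus_periodic F \<longleftrightarrow> (\<forall>a b. torus_param a = torus_param b \<longrightarrow> F a = F b)"

lemma torus_param_add_cong:
  "torus_param a = torus_param b \<Longrightarrow> torus_param (a + x) = torus_param (b + x)"
  by (simp add: torus_param_def vec_eq_iff flip: cis_mult)

lemma torus_param_add_period:
  "torus_param (x + (2 * pi) *\<^sub>R axis i 1) = torus_param x"
  by (auto simp: torus_param_def vec_eq_iff axis_def cis_2pi simp flip: cis_mult)

lemma torus_periodic_add_period:
  "torus_periodic F \<Longrightarrow> F (x + (2 * pi) *\<^sub>R axis i 1) = F x"
  using torus_param_add_period unfolding torus_periodic_def by blast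

lemma torus_periodic_partial_deriv:
  assumes "torus_periodic F"
  shows "torus_periodic (partial_deriv i F)"
  unfolding torus_periodic_def partial_deriv_def
proof (intro allI impI)
  fix a b :: "real ^ 'a" assume "torus_param a = torus_param b"
  then have "F (a + t *\<^sub>R axis i 1) = F (b + t *\<^sub>R axis i 1)" for t
    using assms torus_param_add_cong unfolding torus_periodic_def by blast
  then show "deriv (\<lambda>t. F (a + t *\<^sub>R axis i 1)) 0 = deriv (\<lambda>t. F (b + t *\<^sub>R axis i 1)) 0"
    by simp
qed

lemma torus_periodic_binary:
  assumes "torus_periodic F" "torus_periodic G"
  shows "torus_periodic (\<lambda>x. h (F x) (G x))"
  using assms unfolding torus_periodic_def by metis

abbreviation torus_cube :: "(real ^ 'm::finite) set" where
  "torus_cube \<equiv> cbox 0 (\<chi> i. 2 * pi)"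

text \<open>Compares boxes cut by a half-space one coordinate at a time. The conditions on
  coordinate i are repeated for each j because the cut is equivalent to the new bounds only together
  with them.\<close>

lemma ball_conj_iff_pointwise:
  assumes "\<And>j. P j \<and> P i \<and> Q \<longleftrightarrow> P' j \<and> P' i \<and> Q'"
  shows "(\<forall>j. P j) \<and> Q \<longleftrightarrow> (\<forall>j. P' j) \<and> Q'"
  using assms by metis

text \<open>The translated cube is cut at height 2 pi in direction i. The part above the cut, moved
  back by one period, fills exactly the slab of height t that the translation left
  uncovered.\<close>

lemma integral_cube_shift:
  fixes F :: "real ^ 'm::finite \<Rightarrow> real"
  assumes cont: "continuous_on UNIV F" and per: "\<And>x. F (x + (2 * pi) *\<^sub>R axis i 1) = F x"
    and t: "0 \<le> t" "t \<le> 2 * pi"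
  shows "integral torus_cube (\<lambda>x. F (x + t *\<^sub>R axis i 1)) = integral torus_cube F"
proof -
  define e :: "real ^ 'm" where "e = axis i 1"
  define b :: "real ^ 'm" where "b = (\<chi> i. 2 * pi)"
  have e: "e \<in> Basis" by (simp add: e_def axis_in_Basis_iff)
  have xe: "x \<bullet> e = x $ i" for x by (simp add: e_def inner_axis)
  have ej: "s * e $ j = (if j = i then s else 0)" for s j by (auto simp: e_def axis_def)
  have int: "F integrable_on cbox x y" for x y
    using cont by (intro integrable_continuous continuous_on_subset[OF cont]) auto
  have "integral (cbox 0 b) (\<lambda>x. F (x + t *\<^sub>R e)) = integral (cbox (t *\<^sub>R e) (b + t *\<^sub>R e)) F"
    using integral_shift_cbox_plus[of 0 b F "t *\<^sub>R e"] by (simp add: o_def add.commute)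
  also have "\<dots> = integral (cbox (t *\<^sub>R e) (b + t *\<^sub>R e) \<inter> {x. x \<bullet> e \<le> 2 * pi}) F
      + integral (cbox (t *\<^sub>R e) (b + t *\<^sub>R e) \<inter> {x. x \<bullet> e \<ge> 2 * pi}) F"
    by (rule integral_split[OF int e])
  also have "cbox (t *\<^sub>R e) (b + t *\<^sub>R e) \<inter> {x. x \<bullet> e \<le> 2 * pi} = cbox 0 b \<inter> {x. x \<bullet> e \<ge> t}"
  proof (rule set_eqI)
    fix x
    have "(\<forall>j. (if j = i then t else 0) \<le> x $ j \<and> x $ j \<le> 2 * pi + (if j = i then t else 0)) \<and> x $ i \<le> 2 * pi
      \<longleftrightarrow> (\<forall>j. 0 \<le> x $ j \<and> x $ j \<le> 2 * pi) \<and> t \<le> x $ i"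
      by (rule ball_conj_iff_pointwise[where i = i]) (use t in auto)
    then show "x \<in> cbox (t *\<^sub>R e) (b + t *\<^sub>R e) \<inter> {x. x \<bullet> e \<le> 2 * pi} \<longleftrightarrow> x \<in> cbox 0 b \<inter> {x. x \<bullet> e \<ge> t}"
      by (simp add: mem_box_cart xe ej b_def)
  qed
  also have "integral (cbox (t *\<^sub>R e) (b + t *\<^sub>R e) \<inter> {x. x \<bullet> e \<ge> 2 * pi}) F
      = integral (cbox 0 b \<inter> {x. x \<bullet> e \<le> t}) F"
  proof -
    define c :: "real ^ 'm" where "c = (\<chi> j. if j = i then t else 2 * pi)"
    have "cbox (t *\<^sub>R e) (b + t *\<^sub>R e) \<inter> {x. x \<bullet> e \<ge> 2 * pi} = cbox ((2 * pi) *\<^sub>R e) (c + (2 * pi) *\<^sub>R e)"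
    proof (rule set_eqI)
      fix x
      have "(\<forall>j. (if j = i then t else 0) \<le> x $ j \<and> x $ j \<le> 2 * pi + (if j = i then t else 0)) \<and> x $ i \<ge> 2 * pi
        \<longleftrightarrow> (\<forall>j. (if j = i then 2 * pi else 0) \<le> x $ j \<and>
              x $ j \<le> (if j = i then t else 2 * pi) + (if j = i then 2 * pi else 0))"
        by (rule ball_conj_iff_pointwise[where i = i and Q' = True, simplified]) (use t in auto)
      then show "x \<in> cbox (t *\<^sub>R e) (b + t *\<^sub>R e) \<inter> {x. x \<bullet> e \<ge> 2 * pi}
          \<longleftrightarrow> x \<in> cbox ((2 * pi) *\<^sub>R e) (c + (2 * pi) *\<^sub>R e)"
        by (simp add: mem_box_cart xe ej b_def c_def)
    qed
    moreover have "integral (cbox ((2 * pi) *\<^sub>R e) (c + (2 * pi) *\<^sub>R e)) F = integral (cbox 0 c) F"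
      using integral_shift_cbox_plus[of 0 c F "(2 * pi) *\<^sub>R e"] per
      by (simp add: o_def add.commute e_def)
    moreover have "cbox 0 c = cbox 0 b \<inter> {x. x \<bullet> e \<le> t}"
    proof (rule set_eqI)
      fix x
      have "(\<forall>j. 0 \<le> x $ j \<and> x $ j \<le> (if j = i then t else 2 * pi))
        \<longleftrightarrow> (\<forall>j. 0 \<le> x $ j \<and> x $ j \<le> 2 * pi) \<and> x $ i \<le> t"
        by (rule ball_conj_iff_pointwise[where i = i and Q = True, simplified]) (use t in auto)
      then show "x \<in> cbox 0 c \<longleftrightarrow> x \<in> cbox 0 b \<inter> {x. x \<bullet> e \<le> t}"
        by (simp add: mem_box_cart xe b_def c_def)
    qed
    ultimately show ?thesis by simp
  qed
  also have "integral (cbox 0 b \<inter> {x. x \<bullet> e \<ge> t}) F + integral (cbox 0 b \<inter> {x. x \<bullet> e \<le> t}) F = integral (cbox 0 b) F"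
    using integral_split[OF int e, of 0 b t] by simp
  finally show ?thesis by (simp add: e_def b_def)
qed

text \<open>The integral of a translate of \<open>W\<close> does not depend on the translation;
  differentiating under the integral sign gives the claim without iterated integrals.\<close>

lemma integral_cube_directional_derivative:
  fixes W W' :: "real ^ 'm::finite \<Rightarrow> real"
  assumes cont: "continuous_on UNIV W" "continuous_on UNIV W'"
    and per: "torus_periodic W" "torus_periodic W'"
    and deriv: "\<And>x. ((\<lambda>s. W (x + s *\<^sub>R axis i 1)) has_real_derivative W' x) (at 0)"
  shows "integral torus_cube W' = 0"
proof -
  let ?e = "axis i 1 :: real ^ 'm"
  have cont_comp: "continuous_on S (\<lambda>p. G (snd p + fst p *\<^sub>R ?e))" if "continuous_on UNIV G"
    for S and G :: "real ^ 'm \<Rightarrow> real"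
    by (rule continuous_on_compose2[OF that]) (auto intro!: continuous_intros)
  have cont_shift: "continuous_on S (\<lambda>x. W (x + s *\<^sub>R ?e))" for s S
    by (rule continuous_on_compose2[OF cont(1)]) (auto intro!: continuous_intros)
  have d: "((\<lambda>s. W (x + s *\<^sub>R ?e)) has_real_derivative W' (x + s *\<^sub>R ?e)) (at s)" for s x
    using deriv[of "x + s *\<^sub>R ?e"] DERIV_shift[of "\<lambda>s. W (x + s *\<^sub>R ?e)" "W' (x + s *\<^sub>R ?e)" 0 s]
    by (simp add: scaleR_add_left add_ac)
  \<comment> \<open>\<open>integral_cube_shift\<close> covers shifts between 0 and 2 pi only. The
    derivative is therefore taken at the interior point 1 of {0..2}, and the shift by 1 is undone at
    the end.\<close>
  have "((\<lambda>s. integral torus_cube (\<lambda>x. W (x + s *\<^sub>R ?e))) has_field_derivative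
      integral torus_cube (\<lambda>x. W' (x + 1 *\<^sub>R ?e))) (at 1 within {0..2})"
  proof (rule leibniz_rule_field_derivative[where fx = "\<lambda>s x. W' (x + s *\<^sub>R ?e)"])
    show "((\<lambda>s. W (x + s *\<^sub>R ?e)) has_field_derivative W' (x + s *\<^sub>R ?e)) (at s within {0..2})" for s x
      using d by (rule has_field_derivative_at_within)
    show "(\<lambda>x. W (x + s *\<^sub>R ?e)) integrable_on torus_cube" for s
      by (intro integrable_continuous cont_shift)
    show "continuous_on ({0..2} \<times> torus_cube) (\<lambda>(s, x). W' (x + s *\<^sub>R ?e))"
      using cont_comp[OF cont(2)] by (simp add: case_prod_beta)
  qed auto
  then have "((\<lambda>s. integral torus_cube W) has_field_derivative
      integral torus_cube (\<lambda>x. W' (x + 1 *\<^sub>R ?e))) (at 1 within {0..2})"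
  proof (rule has_field_derivative_transform_within[OF _ zero_less_one])
    show "integral torus_cube (\<lambda>x. W (x + s *\<^sub>R ?e)) = integral torus_cube W" if "s \<in> {0..2}" for s
      using that pi_ge_two
      by (intro integral_cube_shift cont torus_periodic_add_period per) auto
  qed simp
  then have "((\<lambda>s. integral torus_cube W) has_field_derivative
      integral torus_cube (\<lambda>x. W' (x + 1 *\<^sub>R ?e))) (at 1)"
    using at_within_Icc_at[of 0 1 "2 :: real"] by simp
  then have "integral torus_cube (\<lambda>x. W' (x + 1 *\<^sub>R ?e)) = 0"
    by (rule DERIV_unique) simp
  moreover have "integral torus_cube (\<lambda>x. W' (x + 1 *\<^sub>R ?e)) = integral torus_cube W'"
    using pi_ge_two by (intro integral_cube_shift cont torus_periodic_add_period per) auto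
  ultimately show ?thesis by simp
qed

section \<open>Real Fourier modes\<close>

definition phase :: "int ^ 'm::finite \<Rightarrow> real ^ 'm \<Rightarrow> real" where
  "phase k x = (\<Sum>i\<in>UNIV. of_int (k $ i) * x $ i)"

lemma phase_add_axis: "phase k (x + t *\<^sub>R axis i 1) = phase k x + of_int (k $ i) * t"
  by (simp add: phase_def distrib_left sum.distrib axis_def if_distrib[of "\<lambda>y. _ * y"] cong: if_cong)

lemma phase_add: "phase (k + l) x = phase k x + phase l x"
  by (simp add: phase_def distrib_right sum.distrib)

lemma phase_diff: "phase (k - l) x = phase k x - phase l x"
  by (simp add: phase_def left_diff_distrib sum_subtractf)

lemma phase_uminus: "phase (- k) x = - phase k x"
  by (simp add: phase_def sum_negf)

lemma phase_zero: "phase 0 x = 0"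
  by (simp add: phase_def)

lemma phase_axis: "phase (axis i 1) x = x $ i"
  by (simp add: phase_def axis_def if_distrib[of "\<lambda>y. of_int y * _"] cong: if_cong)

lemma continuous_on_phase [continuous_intros]: "continuous_on S (phase k)"
  unfolding phase_def[abs_def] by (intro continuous_intros)

lemma cis_sum: "finite A \<Longrightarrow> cis (\<Sum>i\<in>A. f i) = (\<Prod>i\<in>A. cis (f i))"
  by (induction A rule: finite_induct) (auto simp flip: cis_mult)

lemma cis_phase: "cis (phase k x) = (\<Prod>i\<in>UNIV. (torus_param x $ i) powi (k $ i))"
  by (simp add: phase_def cis_sum torus_param_def cis_power_int)

lemma torus_periodic_cis_phase:
  assumes "\<And>x. F x = h (cis (phase k x))"
  shows "torus_periodic F"
  unfolding torus_periodic_def by (metis assms cis_phase)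

lemma torus_periodic_modes:
  "torus_periodic (\<lambda>x. cos (phase k x))" "torus_periodic (\<lambda>x. sin (phase k x))"
  "torus_periodic (\<lambda>x. cas (phase k x))"
  using torus_periodic_cis_phase[of _ Re k] torus_periodic_cis_phase[of _ Im k]
    torus_periodic_cis_phase[of _ "\<lambda>z. Re z + Im z" k]
  by (simp_all add: cas_def)

text \<open>If \<open>k $ i\<close> is nonzero, translation by pi / |k i| in direction i moves the
  phase by pi or - pi. Both functions change sign while their integrals stay the same.\<close>

lemma integral_cube_modes:
  fixes k :: "int ^ 'm::finite"
  shows "integral torus_cube (\<lambda>x. cos (phase k x)) = (if k = 0 then measure lborel (torus_cube :: (real ^ 'm) set) else 0)"
    and "integral torus_cube (\<lambda>x. sin (phase k x)) = 0"
proof -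
  have cont: "continuous_on UNIV (\<lambda>x. cos (phase k x))" "continuous_on UNIV (\<lambda>x. sin (phase k x))"
    by (intro continuous_intros)+
  have "integral torus_cube (\<lambda>x. cos (phase k x)) = 0 \<and> integral torus_cube (\<lambda>x. sin (phase k x)) = 0"
    if "k \<noteq> 0"
  proof -
    from that obtain i where i: "k $ i \<noteq> 0" by (auto simp: vec_eq_iff)
    define t where "t = pi / \<bar>of_int (k $ i)\<bar>"
    have "1 \<le> \<bar>k $ i\<bar>" using i by linarith
    then have "1 \<le> \<bar>real_of_int (k $ i)\<bar>" by linarith
    then have "t \<le> pi / 1" unfolding t_def by (intro divide_left_mono) auto
    moreover have "0 \<le> t" by (simp add: t_def)
    ultimately have t: "0 \<le> t" "t \<le> 2 * pi" by auto
    have "of_int (k $ i) * t = pi \<or> of_int (k $ i) * t = - pi"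
      using i by (auto simp: t_def abs_if)
    then have flip: "cos (phase k (x + t *\<^sub>R axis i 1)) = - cos (phase k x)"
      "sin (phase k (x + t *\<^sub>R axis i 1)) = - sin (phase k x)" for x
      by (auto simp: phase_add_axis cos_add sin_add)
    show ?thesis
      using integral_cube_shift[OF cont(1) torus_periodic_add_period[OF torus_periodic_modes(1)] t, of i]
        integral_cube_shift[OF cont(2) torus_periodic_add_period[OF torus_periodic_modes(2)] t, of i]
      unfolding flip by simp
  qed
  then show "integral torus_cube (\<lambda>x. cos (phase k x)) = (if k = 0 then measure lborel (torus_cube :: (real ^ 'm) set) else 0)"
    "integral torus_cube (\<lambda>x. sin (phase k x)) = 0"
    by (cases "k = 0"; simp add: phase_zero)+
qed

lemma integral_cube_cas_cas:
  fixes k l :: "int ^ 'm::finite"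
  shows "integral torus_cube (\<lambda>x. cas (phase k x) * cas (phase l x))
    = (if k = l then measure lborel (torus_cube :: (real ^ 'm) set) else 0)"
proof -
  have "integral torus_cube (\<lambda>x. cas (phase k x) * cas (phase l x))
      = integral torus_cube (\<lambda>x. cos (phase (k - l) x)) + integral torus_cube (\<lambda>x. sin (phase (k + l) x))"
    unfolding cas_mult phase_diff[symmetric] phase_add[symmetric]
    by (intro Henstock_Kurzweil_Integration.integral_add integrable_continuous continuous_intros)
  then show ?thesis by (simp add: integral_cube_modes)
qed

section \<open>Partial derivatives and integration by parts\<close>

lemma has_partial_deriv:
  assumes "F differentiable_on UNIV"
  shows "((\<lambda>t. F (x + t *\<^sub>R axis i 1)) has_real_derivative partial_deriv i F x) (at 0)"
proof -
  have "F differentiable at (x + 0 *\<^sub>R axis i 1)"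
    using assms by (simp add: differentiable_on_def)
  moreover have "(\<lambda>t. x + t *\<^sub>R axis i (1::real)) differentiable at (0::real)"
    by (auto intro!: derivative_intros)
  ultimately have "(F \<circ> (\<lambda>t. x + t *\<^sub>R axis i 1)) differentiable at 0"
    by (intro differentiable_chain_at) auto
  then show ?thesis
    unfolding partial_deriv_def o_def
    by (simp add: DERIV_deriv_iff_real_differentiable)
qed

lemma has_real_derivative_phase_axis:
  "((\<lambda>t. phase k (x + t *\<^sub>R axis i 1)) has_real_derivative of_int (k $ i)) (at 0)"
  unfolding phase_add_axis by (auto intro!: derivative_eq_intros)

text \<open>For fixed k this two-parameter family is closed under differentiation, which lets
  smoothness go by induction on the list of derivatives.\<close>

lemma partial_deriv_modes:
  "partial_deriv i (\<lambda>x. a * cos (phase k x) + b * sin (phase k x))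
    = (\<lambda>x. (b * of_int (k $ i)) * cos (phase k x) + (- a * of_int (k $ i)) * sin (phase k x))"
  unfolding partial_deriv_def
  by (intro ext DERIV_imp_deriv)
    (auto intro!: derivative_eq_intros has_real_derivative_phase_axis)

lemma differentiable_modes:
  "(\<lambda>x. a * cos (phase k x) + b * sin (phase k x)) differentiable_on UNIV"
proof -
  have "phase k differentiable at x" for x
    unfolding phase_def[abs_def] by (auto intro!: derivative_intros differentiable_sum
      bounded_linear_imp_differentiable[OF bounded_linear_vec_nth])
  moreover have "cos differentiable at y" "sin differentiable at y" for y :: real
    by (auto simp: real_differentiable_def intro: DERIV_cos DERIV_sin)
  ultimately have "(\<lambda>x. cos (phase k x)) differentiable at x" "(\<lambda>x. sin (phase k x)) differentiable at x" for x
    by (auto intro: differentiable_compose[of cos] differentiable_compose[of sin])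
  then show ?thesis
    unfolding differentiable_on_def by simp
qed

lemma fold_partial_deriv_modes:
  "fold partial_deriv is (\<lambda>x. a * cos (phase k x) + b * sin (phase k x)) differentiable_on UNIV"
  by (induction "is" arbitrary: a b) (simp_all only: fold_Nil fold_Cons id_apply o_apply differentiable_modes partial_deriv_modes)

lemma partial_deriv_twice_cas:
  "partial_deriv i (partial_deriv i (\<lambda>x. c * cas (phase k x))) x = - (of_int (k $ i))\<^sup>2 * (c * cas (phase k x))"
proof -
  have "(\<lambda>x. c * cas (phase k x)) = (\<lambda>x. c * cos (phase k x) + c * sin (phase k x))"
    by (simp add: cas_def distrib_left)
  then show ?thesis
    by (simp only: partial_deriv_modes) (simp add: cas_def power2_eq_square algebra_simps)
qed

lemma integral_by_parts_cas:
  fixes F :: "real ^ 'm::finite \<Rightarrow> real"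
  assumes per: "torus_periodic F" and diff: "\<And>is. fold partial_deriv is F differentiable_on UNIV"
  shows "integral torus_cube (\<lambda>x. partial_deriv i (partial_deriv i F) x * cas (phase k x))
    = - (of_int (k $ i))\<^sup>2 * integral torus_cube (\<lambda>x. F x * cas (phase k x))"
proof -
  let ?F1 = "partial_deriv i F" and ?F2 = "partial_deriv i (partial_deriv i F)"
  let ?q = "of_int (k $ i) :: real"
  define E where "E x = cas (phase k x)" for x
  define E1 where "E1 x = ?q * (cos (phase k x) - sin (phase k x))" for x
  have d: "F differentiable_on UNIV" "?F1 differentiable_on UNIV" "?F2 differentiable_on UNIV"
    using diff[of "[]"] diff[of "[i]"] diff[of "[i, i]"] by simp_all
  note c = differentiable_imp_continuous_on[OF d(1)] differentiable_imp_continuous_on[OF d(2)]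
    differentiable_imp_continuous_on[OF d(3)]
  have cE: "continuous_on UNIV E" "continuous_on UNIV E1"
    unfolding E_def[abs_def] E1_def[abs_def] cas_def by (intro continuous_intros)+
  have dE: "((\<lambda>t. E (x + t *\<^sub>R axis i 1)) has_real_derivative E1 x) (at 0)" for x
    unfolding E_def cas_def E1_def
    by (auto intro!: derivative_eq_intros has_real_derivative_phase_axis simp: algebra_simps)
  have dE1: "((\<lambda>t. E1 (x + t *\<^sub>R axis i 1)) has_real_derivative - ?q\<^sup>2 * E x) (at 0)" for x
    unfolding E_def cas_def E1_def
    by (auto intro!: derivative_eq_intros has_real_derivative_phase_axis simp: algebra_simps power2_eq_square)
  have pE: "torus_periodic E" "torus_periodic E1"
    using torus_periodic_cis_phase[of E "\<lambda>z. Re z + Im z" k]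
      torus_periodic_cis_phase[of E1 "\<lambda>z. ?q * (Re z - Im z)" k]
    by (simp_all add: E_def E1_def cas_def)
  \<comment> \<open>The Wronskian of F and the mode: its derivative in direction i has no
    first-order terms left, so one vanishing integral replaces two integrations by parts.\<close>
  define W where "W x = ?F1 x * E x - F x * E1 x" for x
  define W' where "W' x = ?F2 x * E x + ?q\<^sup>2 * (F x * E x)" for x
  have "integral torus_cube W' = 0"
  proof (rule integral_cube_directional_derivative)
    show "continuous_on UNIV W" "continuous_on UNIV W'"
      unfolding W_def[abs_def] W'_def[abs_def] by (intro continuous_intros c cE)+
    note pp = per torus_periodic_partial_deriv[OF per, of i]
      torus_periodic_partial_deriv[OF torus_periodic_partial_deriv[OF per, of i], of i] pE
    show "torus_periodic W" "torus_periodic W'"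
      unfolding W_def[abs_def] W'_def[abs_def]
      by (intro torus_periodic_binary[where h = "(-)"] torus_periodic_binary[where h = "(*)"] pp,
        intro torus_periodic_binary[where h = "\<lambda>a b. a + ?q\<^sup>2 * b"] torus_periodic_binary[where h = "(*)"] pp)
    show "((\<lambda>s. W (x + s *\<^sub>R axis i 1)) has_real_derivative W' x) (at 0)" for x
      unfolding W_def W'_def
      by (rule derivative_eq_intros has_partial_deriv d dE dE1 refl)+ (simp add: algebra_simps)
  qed
  also have "integral torus_cube W' = integral torus_cube (\<lambda>x. ?F2 x * E x) + integral torus_cube (\<lambda>x. ?q\<^sup>2 * (F x * E x))"
    unfolding W'_def[abs_def]
    by (intro Henstock_Kurzweil_Integration.integral_add integrable_continuous continuous_intros
      continuous_on_subset[OF c(1)] continuous_on_subset[OF c(3)] continuous_on_subset[OF cE(1)]) auto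
  finally show ?thesis by (simp add: E_def)
qed

section \<open>Integration on the torus\<close>

definition torus_angles :: "complex ^ 'm::finite \<Rightarrow> real ^ 'm" where
  "torus_angles p = (\<chi> j. Arg (p $ j))"

lemma torus_param_in_torus: "torus_param x \<in> torus"
  by (simp add: torus_param_def torus_def)

lemma torus_param_angles:
  assumes "p \<in> torus"
  shows "torus_param (torus_angles p) = p"
proof -
  have "cis (Arg (p $ i)) = p $ i" for i
  proof -
    have "norm (p $ i) = 1" using assms by (simp add: torus_def)
    then show ?thesis using rcis_cmod_Arg[of "p $ i"] by (simp add: rcis_def)
  qed
  then show ?thesis by (simp add: torus_param_def torus_angles_def vec_eq_iff)
qed

text \<open>\<open>torus_angles\<close> takes values in (-pi, pi], the fundamental cube is
  [0, 2 pi]; for periodic functions the discrepancy disappears.\<close>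

lemma torus_periodic_angles:
  "torus_periodic F \<Longrightarrow> F (torus_angles (torus_param x)) = F x"
  unfolding torus_periodic_def using torus_param_angles[OF torus_param_in_torus] by blast

lemma continuous_on_torus_param: "continuous_on S torus_param"
  unfolding torus_param_def[abs_def] by (intro continuous_intros)

lemma compact_torus: "compact (torus :: (complex ^ 'm::finite) set)"
proof -
  have "(torus :: (complex ^ 'm) set) = torus_param ` cbox (\<chi> i. - pi) (\<chi> i. pi)"
  proof
    show "(torus :: (complex ^ 'm) set) \<subseteq> torus_param ` cbox (\<chi> i. - pi) (\<chi> i. pi)"
    proof
      fix p :: "complex ^ 'm" assume "p \<in> torus"
      then have "p = torus_param (torus_angles p)" by (simp add: torus_param_angles)
      moreover have "torus_angles p \<in> cbox (\<chi> i. - pi) (\<chi> i. pi)"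
        using mpi_less_Arg Arg_le_pi by (simp add: torus_angles_def mem_box_cart less_imp_le)
      ultimately show "p \<in> torus_param ` cbox (\<chi> i. - pi) (\<chi> i. pi)" by (rule image_eqI)
    qed
  qed (auto simp: torus_param_in_torus)
  moreover have "compact (torus_param ` cbox (\<chi> i. - pi) (\<chi> i. pi) :: (complex ^ 'm) set)"
    by (intro compact_continuous_image continuous_on_torus_param compact_cbox)
  ultimately show ?thesis by (rule ssubst)
qed

lemma space_torus_measure: "space torus_measure = torus"
  by (simp add: torus_measure_def space_restrict_space)

lemma sets_torus_measure: "sets torus_measure = sets (restrict_space borel torus)"
  by (simp add: torus_measure_def)

lemma borel_measurable_torus_measure:
  "(f \<in> borel_measurable torus_measure) = (f \<in> borel_measurable (restrict_space borel torus))"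
  by (rule arg_cong2[where f = "(\<in>)", OF refl measurable_cong_sets]) (simp_all add: sets_torus_measure)

lemma measurable_torus_param:
  "torus_param \<in> restrict_space lborel torus_cube \<rightarrow>\<^sub>M restrict_space borel torus"
proof (rule measurable_restrict_space2)
  show "torus_param \<in> space (restrict_space lborel torus_cube) \<rightarrow> torus"
    by (simp add: torus_param_in_torus)
  have "torus_param \<in> borel \<rightarrow>\<^sub>M borel"
    by (rule borel_measurable_continuous_onI[OF continuous_on_torus_param])
  then show "torus_param \<in> restrict_space lborel torus_cube \<rightarrow>\<^sub>M borel"
    by (intro measurable_restrict_space1) simp
qed

text \<open>Arg is continuous off the nonpositive real axis, and on that axis it takes just two
  values: 0 at the origin and pi elsewhere.\<close>

lemma borel_measurable_Arg: "Arg \<in> borel_measurable borel"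
proof -
  have "(\<lambda>z. if z \<in> \<real>\<^sub>\<le>\<^sub>0 then (if 0 \<le> Re z then 0 else pi) else Arg z) \<in> borel_measurable borel"
  proof (rule measurable_If_restrict_space_iff[THEN iffD2], rule_tac [2] conjI)
    show "Arg \<in> borel_measurable (restrict_space borel {z. z \<notin> \<real>\<^sub>\<le>\<^sub>0})"
      by (rule borel_measurable_continuous_on_restrict) (auto intro!: continuous_intros)
  qed (auto intro!: measurable_restrict_space1)
  also have "(\<lambda>z. if z \<in> \<real>\<^sub>\<le>\<^sub>0 then (if 0 \<le> Re z then 0 else pi) else Arg z) = Arg"
    by (auto simp: fun_eq_iff Arg_real nonpos_Reals_subset_Reals[THEN subsetD])
  finally show ?thesis .
qed

lemma borel_measurable_torus_angles:
  "(torus_angles :: complex ^ 'm::finite \<Rightarrow> _) \<in> borel_measurable (restrict_space borel torus)"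
proof (rule measurable_restrict_space1, subst borel_measurable_euclidean_space, rule ballI)
  fix b :: "real ^ 'm" assume "b \<in> Basis"
  then obtain j where b: "b = axis j 1" by (auto simp: Basis_vec_def)
  have "(\<lambda>p :: complex ^ 'm. Arg (p $ j)) \<in> borel_measurable borel"
    by (rule measurable_compose[OF _ borel_measurable_Arg])
      (intro borel_measurable_continuous_onI continuous_intros)
  then show "(\<lambda>p. torus_angles p \<bullet> b) \<in> borel_measurable borel"
    by (simp add: b inner_axis torus_angles_def)
qed

text \<open>A function on the torus is represented by its periodic lift, and its integral becomes a
  Henstock--Kurzweil integral over the cube.\<close>

lemma torus_lift:
  fixes F :: "real ^ 'm::finite \<Rightarrow> real"
  assumes cont: "continuous_on UNIV F" and per: "torus_periodic F"
    and \<phi>: "\<And>p. p \<in> torus \<Longrightarrow> \<phi> p = F (torus_angles p)"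
  shows "\<phi> \<in> borel_measurable torus_measure"
    and "integrable torus_measure \<phi>"
    and "integral\<^sup>L torus_measure \<phi> = integral torus_cube F"
proof -
  have "(\<lambda>p. F (torus_angles p)) \<in> borel_measurable (restrict_space borel torus)"
    by (rule measurable_compose[OF borel_measurable_torus_angles borel_measurable_continuous_onI[OF cont]])
  then have meas: "\<phi> \<in> borel_measurable (restrict_space borel torus)"
    by (rule measurable_cong[THEN iffD1, rotated]) (simp add: \<phi> space_restrict_space)
  then show "\<phi> \<in> borel_measurable torus_measure" by (simp add: borel_measurable_torus_measure)
  have lift: "\<phi> (torus_param x) = F x" for x
    by (simp add: \<phi> torus_param_in_torus torus_periodic_angles[OF per])
  have int: "integrable lborel (\<lambda>x. indicator torus_cube x *\<^sub>R F x)"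
    by (intro borel_integrable_compact compact_cbox continuous_on_subset[OF cont]) auto
  then show "integrable torus_measure \<phi>"
    unfolding torus_measure_def integrable_distr_eq[OF measurable_torus_param meas] lift
    by (subst integrable_restrict_space) auto
  have "integral\<^sup>L torus_measure \<phi> = integral\<^sup>L (restrict_space lborel torus_cube) F"
    unfolding torus_measure_def integral_distr[OF measurable_torus_param meas] lift ..
  also have "\<dots> = (LINT x:torus_cube|lborel. F x)"
    unfolding set_lebesgue_integral_def by (subst integral_restrict_space) auto
  also have "\<dots> = integral torus_cube F"
    using int by (intro set_borel_integral_eq_integral) (simp add: set_integrable_def)
  finally show "integral\<^sup>L torus_measure \<phi> = integral torus_cube F" .
qed

lemma L2_torus_lift:
  assumes "continuous_on UNIV F" "torus_periodic F" "\<And>p. p \<in> torus \<Longrightarrow> \<phi> p = F (torus_angles p)"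
  shows "\<phi> \<in> L2_space torus_measure"
proof -
  have "integrable torus_measure (\<lambda>p. (\<phi> p)\<^sup>2)"
    using assms
    by (intro torus_lift(2)[where F = "\<lambda>x. (F x)\<^sup>2"] continuous_intros
      torus_periodic_binary[where h = "\<lambda>a b. a\<^sup>2"]) auto
  with torus_lift(1)[OF assms] show ?thesis by (simp add: L2_space_def)
qed

lemma L2_inner_torus_lift:
  assumes "continuous_on UNIV F" "torus_periodic F" "\<And>p. p \<in> torus \<Longrightarrow> \<phi> p = F (torus_angles p)"
    and "continuous_on UNIV G" "torus_periodic G" "\<And>p. p \<in> torus \<Longrightarrow> \<psi> p = G (torus_angles p)"
  shows "L2_inner torus_measure \<phi> \<psi> = integral torus_cube (\<lambda>x. F x * G x)"
  unfolding L2_inner_def using assms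
  by (intro torus_lift(3) continuous_intros torus_periodic_binary[where h = "(*)"]) auto

lemma integrable_torus_const: "integrable torus_measure (\<lambda>p. c :: real)"
  by (rule torus_lift(2)[where F = "\<lambda>x. c"]) (auto simp: torus_periodic_def)

lemma finite_measure_torus: "finite_measure torus_measure"
  using integrable_torus_const[of 1] by (intro finite_measureI) (simp add: integrable_iff_bounded less_top)

lemma L2_torus_bounded:
  assumes "g \<in> borel_measurable torus_measure" "\<And>p. p \<in> torus \<Longrightarrow> \<bar>g p\<bar> \<le> B"
  shows "g \<in> L2_space torus_measure"
proof -
  have "integrable torus_measure (\<lambda>p. (g p)\<^sup>2)"
  proof (rule Bochner_Integration.integrable_bound[OF integrable_torus_const[of "B\<^sup>2"]])
    have "norm ((g p)\<^sup>2) \<le> norm (B\<^sup>2)" if "p \<in> torus" for p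
      using assms(2)[OF that] power_mono[OF assms(2)[OF that], of 2] by simp
    then show "AE p in torus_measure. norm ((g p)\<^sup>2) \<le> norm (B\<^sup>2)"
      by (intro AE_I2) (simp add: space_torus_measure)
  qed (use assms in measurable)
  with assms show ?thesis by (simp add: L2_space_def)
qed

lemma integrable_L2_torus:
  assumes "f \<in> L2_space torus_measure"
  shows "integrable torus_measure f"
  using L2_mult_integrable[OF assms L2_torus_lift[of "\<lambda>x. 1" "\<lambda>p. 1"]] by (simp add: torus_periodic_def)

section \<open>Completeness of the real Fourier modes\<close>

text \<open>The real trigonometric polynomials. Closure under products is not built in; it follows
  from the addition formulas.\<close>

inductive_set torus_trig :: "(complex ^ 'm::finite \<Rightarrow> real) set" where
  mode: "(\<lambda>p. c * cas (phase k (torus_angles p))) \<in> torus_trig"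
| add: "f \<in> torus_trig \<Longrightarrow> g \<in> torus_trig \<Longrightarrow> (\<lambda>p. f p + g p) \<in> torus_trig"

text \<open>\<open>cas_mult\<close> yields a cosine and a sine, which are half the sum and half the
  difference of cas t and cas (- t); a product of two modes is thus a combination of four.\<close>

lemma torus_trig_mult_mode:
  assumes "g \<in> torus_trig"
  shows "(\<lambda>p. (c * cas (phase k (torus_angles p))) * g p) \<in> torus_trig"
  using assms
proof induction
  case (mode d l)
  have "cas a * cas b = (cas (a - b) + cas (- (a - b))) / 2 + (cas (a + b) - cas (- (a + b))) / 2" for a b
    by (simp add: cas_mult cas_def[of "a - b"] cas_def[of "a + b"] cas_def[of "- (a - b)"] cas_def[of "- (a + b)"] del: minus_diff_eq minus_add_distrib)
  moreover have "(c * s) * (d * t) = c * d / 2 * u + c * d / 2 * v + (c * d / 2 * w + (- c * d / 2) * z)"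
    if "s * t = (u + v) / 2 + (w - z) / 2" for s t u v w z :: real
  proof -
    have "(c * s) * (d * t) = c * d * (s * t)" by simp
    then show ?thesis unfolding that by (simp add: field_simps)
  qed
  ultimately have "(c * cas (phase k x)) * (d * cas (phase l x)) =
      c * d / 2 * cas (phase (k - l) x) + c * d / 2 * cas (phase (- (k - l)) x) +
      (c * d / 2 * cas (phase (k + l) x) + (- c * d / 2) * cas (phase (- (k + l)) x))" for x
    unfolding phase_uminus phase_diff phase_add by blast
  then show ?case by (simp only:) (intro torus_trig.intros)
qed (auto simp: distrib_left intro: torus_trig.add)

lemma torus_trig_mult:
  assumes "f \<in> torus_trig" "g \<in> torus_trig"
  shows "(\<lambda>p. f p * g p) \<in> torus_trig"
  using assms by induction (auto simp: distrib_right intro: torus_trig.add torus_trig_mult_mode)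

text \<open>\<open>torus_angles\<close> jumps, but the phase enters only through \<open>cis\<close>,
  which is a Laurent monomial in the coordinates of p.\<close>

lemma continuous_on_mode: "continuous_on torus (\<lambda>p. cas (phase k (torus_angles p)))"
proof -
  let ?z = "\<lambda>p. \<Prod>i\<in>UNIV. (p $ i) powi (k $ i)"
  have nonzero: "p $ i \<noteq> 0" if "p \<in> torus" for p :: "complex ^ 'a" and i
    using that by (auto simp: torus_def dest!: spec[of _ i])
  have "continuous_on torus (\<lambda>p. Re (?z p) + Im (?z p))"
    by (intro continuous_intros continuous_on_power_int) (use nonzero in auto)
  then show ?thesis
    by (rule continuous_on_eq) (simp add: cas_eq_cis cis_phase torus_param_angles)
qed

lemma continuous_on_torus_trig: "f \<in> torus_trig \<Longrightarrow> continuous_on torus f"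
  by (induction rule: torus_trig.induct) (auto intro!: continuous_intros continuous_on_mode)

lemma L2_continuous_on_torus:
  assumes "continuous_on torus g"
  shows "g \<in> L2_space torus_measure"
proof -
  have "compact (g ` torus)" using assms compact_torus by (rule compact_continuous_image)
  then obtain B where "\<forall>p\<in>torus. \<bar>g p\<bar> \<le> B"
    by (auto dest!: compact_imp_bounded simp: bounded_iff)
  then show ?thesis
    using borel_measurable_continuous_on_restrict[OF assms]
    by (intro L2_torus_bounded[of _ B]) (simp_all add: borel_measurable_torus_measure)
qed

lemma function_ring_on_torus_trig: "function_ring_on torus_trig (torus :: (complex ^ 'm::finite) set)"
proof
  fix x y :: "complex ^ 'm" assume xy: "x \<in> torus" "y \<in> torus" "x \<noteq> y"
  then obtain i where i: "x $ i \<noteq> y $ i" by (auto simp: vec_eq_iff)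
  show "\<exists>f\<in>torus_trig. f x \<noteq> f y"
  proof (rule ccontr)
    assume "\<not> (\<exists>f\<in>torus_trig. f x \<noteq> f y)"
    then have eq: "f x = f y" if "f \<in> torus_trig" for f using that by blast
    have cas: "cas (phase k (torus_angles x)) = cas (phase k (torus_angles y))" for k
      using eq[OF torus_trig.mode[of 1 k]] by simp
    \<comment> \<open>The unit frequencies in direction i and their negatives recover cosine and
      sine separately.\<close>
    have "cos (torus_angles x $ i) = cos (torus_angles y $ i)" "sin (torus_angles x $ i) = sin (torus_angles y $ i)"
      using cas[of "axis i 1"] cas[of "- axis i 1"] by (simp_all add: phase_uminus phase_axis cas_def)
    then have "torus_param (torus_angles x) $ i = torus_param (torus_angles y) $ i"
      by (simp add: torus_param_def complex_eq_iff)
    with i xy show False by (simp add: torus_param_angles)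
  qed
next
  show "(\<lambda>_. c) \<in> torus_trig" for c
    using torus_trig.mode[of c 0] by (simp add: phase_zero cas_def)
qed (auto intro: compact_torus continuous_on_torus_trig torus_trig.add torus_trig_mult)

text \<open>Orthogonality extends from trigonometric polynomials to continuous functions by
  Stone-Weierstrass, since f is integrable; to indicators of closed sets by dominated convergence;
  and to all Borel sets by the pi-lambda theorem. A density whose integrals all vanish is
  zero.\<close>

lemma L2_torus_eq_0:
  fixes f :: "complex ^ 'm::finite \<Rightarrow> real"
  assumes f: "f \<in> L2_space torus_measure"
    and orth: "\<And>k. L2_inner torus_measure f (\<lambda>p. cas (phase k (torus_angles p))) = 0"
  shows "AE p in torus_measure. f p = 0"
proof -
  let ?M = "torus_measure :: (complex ^ 'm) measure"
  have f_int: "integrable ?M f" by (rule integrable_L2_torus[OF f])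
  have f_meas[measurable]: "f \<in> borel_measurable ?M" using f by (rule L2_spaceD)
  have trig: "L2_inner ?M f g = 0" if "g \<in> torus_trig" for g
    using that
  proof induction
    case (add g h)
    then show ?case
      using L2_inner_add_left[OF L2_continuous_on_torus L2_continuous_on_torus f, of g h]
      by (simp add: continuous_on_torus_trig L2_inner_commute[of _ f])
  qed (simp add: L2_inner_scale_right orth)
  have cont: "L2_inner ?M f g = 0" if g: "continuous_on torus g" for g
  proof -
    have "\<bar>L2_inner ?M f g\<bar> \<le> e * (LINT p|?M. \<bar>f p\<bar>)" if e: "0 < e" for e
    proof -
      obtain h where h: "h \<in> torus_trig" "\<And>p. p \<in> torus \<Longrightarrow> \<bar>g p - h p\<bar> < e"
        using function_ring_on.Stone_Weierstrass_basic[OF function_ring_on_torus_trig g e] by blast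
      have L2: "g \<in> L2_space ?M" "h \<in> L2_space ?M"
        using g h continuous_on_torus_trig by (auto intro: L2_continuous_on_torus)
      have "L2_inner ?M f g = L2_inner ?M f (\<lambda>p. g p - h p)"
        using trig[OF h(1)] by (simp add: L2_inner_diff_right L2 f)
      also have "\<bar>\<dots>\<bar> \<le> (LINT p|?M. \<bar>f p * (g p - h p)\<bar>)"
        unfolding L2_inner_def by (rule integral_abs_bound)
      also have "\<dots> \<le> (LINT p|?M. e * \<bar>f p\<bar>)"
      proof (rule integral_mono)
        show "integrable ?M (\<lambda>p. \<bar>f p * (g p - h p)\<bar>)"
          by (intro integrable_abs L2_mult_integrable f L2_diff L2)
        show "integrable ?M (\<lambda>p. e * \<bar>f p\<bar>)"
          by (intro integrable_mult_right integrable_abs f_int)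
        show "\<bar>f p * (g p - h p)\<bar> \<le> e * \<bar>f p\<bar>" if "p \<in> space ?M" for p
          using h(2)[of p] that by (auto simp: space_torus_measure abs_mult mult.commute[of e] intro!: mult_left_mono)
      qed
      finally show ?thesis by simp
    qed
    moreover define C where "C = (LINT p|?M. \<bar>f p\<bar>)"
    moreover have "0 \<le> C" by (simp add: C_def)
    ultimately have le: "\<bar>L2_inner ?M f g\<bar> \<le> e * C" if "0 < e" for e
      using that by simp
    have "\<bar>L2_inner ?M f g\<bar> \<le> 0"
    proof (rule field_le_epsilon)
      fix e :: real assume e: "0 < e"
      \<comment> \<open>C may be 0, so the division is by C + 1.\<close>
      have "e / (C + 1) * C \<le> e" using e \<open>0 \<le> C\<close> by (simp add: field_simps)
      moreover have "0 < e / (C + 1)" using e \<open>0 \<le> C\<close> by simp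
      ultimately show "\<bar>L2_inner ?M f g\<bar> \<le> 0 + e" using le[of "e / (C + 1)"] by linarith
    qed
    then show ?thesis by simp
  qed
  have sets: "torus \<inter> A \<in> sets ?M" if "A \<in> sets borel" for A
    using that by (auto simp: sets_torus_measure sets_restrict_space)
  have set_int: "set_integrable ?M (torus \<inter> A) f" if "A \<in> sets borel" for A
    unfolding set_integrable_def by (rule integrable_mult_indicator[OF sets[OF that] f_int])
  define Z where "Z A \<longleftrightarrow> (LINT p:torus \<inter> A|?M. f p) = 0" for A
  have closed: "Z C" if C: "closed C" for C
  proof (cases "C = {}")
    case False
    \<comment> \<open>Continuous functions decreasing to the indicator of C. The empty set is
      treated apart because \<open>infdist\<close> to it is 0, which would make every
      \<open>g n\<close> constantly 1.\<close>
    define g where "g n p = max 0 (1 - real n * infdist p C)" for n p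
    have "(\<lambda>n. LINT p|?M. f p * g n p) \<longlonglongrightarrow> (LINT p|?M. indicator (torus \<inter> C) p *\<^sub>R f p)"
    proof (rule integral_dominated_convergence[where w = "\<lambda>p. \<bar>f p\<bar>"])
      show "AE p in ?M. (\<lambda>n. f p * g n p) \<longlonglongrightarrow> indicator (torus \<inter> C) p *\<^sub>R f p"
      proof (rule AE_I2)
        fix p assume "p \<in> space ?M"
        then have p: "indicator (torus \<inter> C) p = (indicator C p :: real)"
          by (simp add: space_torus_measure indicator_def)
        have "(\<lambda>n. g n p) \<longlonglongrightarrow> indicator C p"
        proof (cases "p \<in> C")
          case False
          then have d: "0 < infdist p C"
            using C \<open>C \<noteq> {}\<close> in_closed_iff_infdist_zero[of C p] infdist_nonneg[of p C] by fastforce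
          obtain N where N: "1 / infdist p C < real N" using reals_Archimedean2 by blast
          have "g n p = 0" if "N \<le> n" for n
          proof -
            have "1 / infdist p C \<le> real n" using N that by linarith
            then show ?thesis using d by (simp add: g_def divide_le_eq)
          qed
          then have "\<forall>\<^sub>F n in sequentially. 0 = g n p"
            unfolding eventually_sequentially by metis
          then have "(\<lambda>n. g n p) \<longlonglongrightarrow> 0"
            by (rule Lim_transform_eventually[OF tendsto_const])
          then show ?thesis using False by simp
        qed (simp add: g_def)
        then have "(\<lambda>n. f p * g n p) \<longlonglongrightarrow> f p * indicator C p" by (intro tendsto_intros)
        then show "(\<lambda>n. f p * g n p) \<longlonglongrightarrow> indicator (torus \<inter> C) p *\<^sub>R f p" by (simp add: p mult.commute)
      qed
      show "AE p in ?M. norm (f p * g n p) \<le> \<bar>f p\<bar>" for n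
      proof (rule AE_I2)
        fix p
        have "\<bar>g n p\<bar> \<le> 1" by (simp add: g_def infdist_nonneg)
        then show "norm (f p * g n p) \<le> \<bar>f p\<bar>" by (simp add: abs_mult mult_left_le)
      qed
      have "g n \<in> borel_measurable ?M" for n
        unfolding borel_measurable_torus_measure g_def[abs_def]
        by (intro borel_measurable_continuous_on_restrict continuous_intros)
      then show "(\<lambda>p. f p * g n p) \<in> borel_measurable ?M" for n by measurable
      show "(\<lambda>p. indicator (torus \<inter> C) p *\<^sub>R f p) \<in> borel_measurable ?M"
        using set_int[of C] C unfolding set_integrable_def by (simp add: borel_measurable_integrable)
    qed (use f_int in simp)
    moreover have "(LINT p|?M. f p * g n p) = 0" for n
    proof -
      have "continuous_on torus (g n)" unfolding g_def[abs_def] by (intro continuous_intros)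
      then show ?thesis using cont[of "g n"] by (simp add: L2_inner_def)
    qed
    ultimately show ?thesis by (simp add: Z_def set_lebesgue_integral_def LIMSEQ_const_iff)
  qed (simp add: Z_def set_lebesgue_integral_def)
  have stable: "Int_stable (Collect closed :: (complex ^ 'm) set set)"
    and sub: "Collect closed \<subseteq> Pow (UNIV :: (complex ^ 'm) set)"
    by (auto simp: Int_stable_def)
  have Z: "Z A" if "A \<in> sigma_sets UNIV (Collect closed)" for A
    using stable sub that
  proof (induction rule: sigma_sets_induct_disjoint)
    case (basic A)
    then show ?case using closed by simp
  next
    case empty
    then show ?case by (simp add: Z_def set_lebesgue_integral_def)
  next
    case (compl A)
    then have A: "A \<in> sets borel" by (simp add: borel_eq_closed)
    have "(LINT p:(torus \<inter> A) \<union> (torus \<inter> (UNIV - A))|?M. f p)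
        = (LINT p:torus \<inter> A|?M. f p) + (LINT p:torus \<inter> (UNIV - A)|?M. f p)"
      using A by (intro set_integral_Un set_int) auto
    moreover have "(torus \<inter> A) \<union> (torus \<inter> (UNIV - A)) = torus \<inter> UNIV" by auto
    \<comment> \<open>Passing to complements needs the integral over the whole torus to vanish: this
      is the closed set UNIV.\<close>
    ultimately show ?case using compl.IH closed[of UNIV] by (simp add: Z_def)
  next
    case (union A)
    then have A: "A i \<in> sets borel" for i by (auto simp: borel_eq_closed)
    have U: "torus \<inter> (\<Union>i. A i) = (\<Union>i. torus \<inter> A i)" by auto
    have "set_integrable ?M (\<Union>i. torus \<inter> A i) f"
      unfolding U[symmetric] using A by (intro set_int) auto
    then have "(LINT p:(\<Union>i. torus \<inter> A i)|?M. f p) = (\<Sum>i. LINT p:torus \<inter> A i|?M. f p)"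
      using union.hyps(1) A sets
      by (intro lebesgue_integral_countable_add) (auto simp: disjoint_family_on_def)
    with union.IH show ?case unfolding Z_def U by simp
  qed
  show ?thesis
  proof (rule sigma_finite_measure.density_zero[OF finite_measure.axioms(1)[OF finite_measure_torus] f_int])
    fix A assume "A \<in> sets ?M"
    then obtain A' where A': "A' \<in> sets borel" "A = torus \<inter> A'"
      by (auto simp: sets_torus_measure sets_restrict_space)
    then have "Z A'" using Z by (simp add: borel_eq_closed)
    then show "(LINT p:A|?M. f p) = 0" by (simp add: Z_def A'(2))
  qed
qed

section \<open>The Laplace--Beltrami operator\<close>

definition torus_hartley :: "int ^ 'm::finite \<Rightarrow> complex ^ 'm \<Rightarrow> real" where
  "torus_hartley k p =
     1 / sqrt (measure lborel (torus_cube :: (real ^ 'm) set)) * cas (phase k (torus_angles p))"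

lemma measure_torus_cube_pos: "0 < measure lborel (torus_cube :: (real ^ 'm::finite) set)"
proof -
  have "torus_cube \<noteq> ({} :: (real ^ 'm) set)" by (simp add: interval_eq_empty_cart not_less)
  then have "measure lborel (torus_cube :: (real ^ 'm) set) = (\<Prod>i\<in>(UNIV :: 'm set). 2 * pi)"
    by (simp add: content_cbox_cart)
  then show ?thesis by (simp only:) (intro prod_pos, simp)
qed

lemma torus_hartley_lift:
  fixes k :: "int ^ 'm::finite"
  defines "F \<equiv> \<lambda>x. 1 / sqrt (measure lborel (torus_cube :: (real ^ 'm) set)) * cas (phase k x)"
  shows "continuous_on UNIV F" "torus_periodic F" "torus_hartley k p = F (torus_angles p)"
    "torus_hartley k \<circ> torus_param = F"
proof -
  show "continuous_on UNIV F" unfolding F_def cas_def by (intro continuous_intros)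
  show per: "torus_periodic F"
    unfolding F_def
    by (rule torus_periodic_binary[OF torus_periodic_modes(3) torus_periodic_modes(3),
      where h = "\<lambda>a b. 1 / sqrt (measure lborel (torus_cube :: (real ^ 'm) set)) * a"])
  show lift: "torus_hartley k p = F (torus_angles p)" for p by (simp add: torus_hartley_def F_def)
  show "torus_hartley k \<circ> torus_param = F"
    by (rule ext) (simp add: lift torus_periodic_angles[OF per])
qed

lemma L2_torus_hartley: "torus_hartley k \<in> L2_space torus_measure"
  by (rule L2_torus_lift[OF torus_hartley_lift(1-3)])

lemma L2_basis_torus_hartley:
  "L2_basis torus_measure UNIV (torus_hartley :: int ^ 'm::finite \<Rightarrow> _)"
proof
  fix k l :: "int ^ 'm"
  let ?v = "measure lborel (torus_cube :: (real ^ 'm) set)"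
  show "torus_hartley k \<in> L2_space torus_measure" by (rule L2_torus_hartley)
  have "L2_inner torus_measure (torus_hartley k) (torus_hartley l)
      = integral torus_cube (\<lambda>x. 1 / sqrt ?v * cas (phase k x) * (1 / sqrt ?v * cas (phase l x)))"
    by (rule L2_inner_torus_lift) (rule torus_hartley_lift)+
  also have "\<dots> = integral torus_cube (\<lambda>x. 1 / ?v * (cas (phase k x) * cas (phase l x)))"
    using measure_torus_cube_pos[where 'm = 'm]
    by (intro Henstock_Kurzweil_Integration.integral_cong) (simp add: real_sqrt_mult_self)
  also have "\<dots> = (if k = l then 1 else 0)"
    using measure_torus_cube_pos[where 'm = 'm] by (simp only: integral_mult_right integral_cube_cas_cas) simp
  finally show "L2_inner torus_measure (torus_hartley k) (torus_hartley l) = (if k = l then 1 else 0)" .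
next
  fix f :: "complex ^ 'm \<Rightarrow> real"
  assume f: "f \<in> L2_space torus_measure"
    and orth: "\<And>k. k \<in> UNIV \<Longrightarrow> L2_inner torus_measure f (torus_hartley k) = 0"
  show "AE p in torus_measure. f p = 0"
  proof (rule L2_torus_eq_0[OF f])
    fix k :: "int ^ 'm"
    have "1 / sqrt (measure lborel (torus_cube :: (real ^ 'm) set)) *
        L2_inner torus_measure f (\<lambda>p. cas (phase k (torus_angles p))) = 0"
      using orth[of k] unfolding torus_hartley_def[abs_def] by (simp only: L2_inner_scale_right UNIV_I)
    then show "L2_inner torus_measure f (\<lambda>p. cas (phase k (torus_angles p))) = 0"
      using measure_torus_cube_pos[where 'm = 'm] by simp
  qed
qed

lemma smooth_torus_hartley: "smooth_on_torus (torus_hartley k)"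
  unfolding smooth_on_torus_def torus_hartley_lift(4)
  using fold_partial_deriv_modes by (simp only: cas_def distrib_left) blast

lemma smooth_laplacian_torus_hartley:
  "smooth_laplacian (torus_hartley k) = (\<lambda>p. torus_eigenvalue k * torus_hartley k p)"
  unfolding smooth_laplacian_def[abs_def] torus_hartley_lift(4) partial_deriv_twice_cas
  by (simp add: torus_angles_def[symmetric] torus_hartley_def torus_eigenvalue_def sum_distrib_right
    sum_divide_distrib sum_negf)

text \<open>The coefficient formula lets Parseval's identity compare both sides of the weak equation
  for every smooth test function.\<close>

lemma L2_smooth_on_torus:
  assumes "smooth_on_torus \<phi>"
  shows "\<phi> \<in> L2_space torus_measure" "smooth_laplacian \<phi> \<in> L2_space torus_measure"
    and "L2_inner torus_measure (smooth_laplacian \<phi>) (torus_hartley k)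
      = torus_eigenvalue k * L2_inner torus_measure \<phi> (torus_hartley k)"
proof -
  define F where "F = \<phi> \<circ> torus_param"
  define D where "D x = - (\<Sum>i\<in>UNIV. partial_deriv i (partial_deriv i F) x)" for x
  have diff: "fold partial_deriv is F differentiable_on UNIV" for "is"
    using assms by (simp add: smooth_on_torus_def F_def)
  have per: "torus_periodic F" by (simp add: torus_periodic_def F_def)
  have F: "continuous_on UNIV F" "continuous_on UNIV (partial_deriv i (partial_deriv i F))" for i
    using diff[of "[]"] diff[of "[i, i]"] by (auto intro: differentiable_imp_continuous_on)
  have lift: "\<phi> p = F (torus_angles p)" if "p \<in> torus" for p
    using that by (simp add: F_def torus_param_angles)
  show "\<phi> \<in> L2_space torus_measure" using F(1) per lift by (rule L2_torus_lift)
  have D_cont: "continuous_on UNIV D" unfolding D_def[abs_def] by (intro continuous_intros F)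
  have D_per: "torus_periodic D"
    unfolding torus_periodic_def
  proof (intro allI impI)
    fix a b :: "real ^ 'a" assume ab: "torus_param a = torus_param b"
    have "partial_deriv i (partial_deriv i F) a = partial_deriv i (partial_deriv i F) b" for i
      using torus_periodic_partial_deriv[OF torus_periodic_partial_deriv[OF per], of i i] ab
      unfolding torus_periodic_def by blast
    then show "D a = D b" by (simp add: D_def)
  qed
  have D_lift: "smooth_laplacian \<phi> p = D (torus_angles p)" for p
    by (simp add: smooth_laplacian_def D_def F_def torus_angles_def)
  show "smooth_laplacian \<phi> \<in> L2_space torus_measure"
    using D_cont D_per D_lift by (rule L2_torus_lift)
  let ?E = "\<lambda>x. 1 / sqrt (measure lborel (torus_cube :: (real ^ 'a) set)) * cas (phase k x)"
  let ?v = "1 / sqrt (measure lborel (torus_cube :: (real ^ 'a) set))"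
  have "L2_inner torus_measure (smooth_laplacian \<phi>) (torus_hartley k) = integral torus_cube (\<lambda>x. D x * ?E x)"
    by (rule L2_inner_torus_lift[OF D_cont D_per D_lift]) (rule torus_hartley_lift)+
  also have "\<dots> = integral torus_cube
      (\<lambda>x. \<Sum>i\<in>UNIV. - ?v * (partial_deriv i (partial_deriv i F) x * cas (phase k x)))"
    by (intro Henstock_Kurzweil_Integration.integral_cong)
      (simp add: D_def sum_negf flip: sum_distrib_right sum_divide_distrib)
  also have "\<dots> = (\<Sum>i\<in>UNIV. integral torus_cube
      (\<lambda>x. - ?v * (partial_deriv i (partial_deriv i F) x * cas (phase k x))))"
    unfolding cas_def
    by (intro Henstock_Kurzweil_Integration.integral_sum integrable_continuous continuous_intros
      continuous_on_subset[OF F(2)]) auto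
  also have "\<dots> = (\<Sum>i\<in>UNIV. - ?v * (- (of_int (k $ i))\<^sup>2 * integral torus_cube (\<lambda>x. F x * cas (phase k x))))"
    by (simp only: integral_mult_right integral_by_parts_cas[OF per diff])
  also have "\<dots> = torus_eigenvalue k * (?v * integral torus_cube (\<lambda>x. F x * cas (phase k x)))"
    unfolding torus_eigenvalue_def sum_distrib_right by (intro sum.cong) auto
  also have "?v * integral torus_cube (\<lambda>x. F x * cas (phase k x)) = integral torus_cube (\<lambda>x. F x * ?E x)"
    unfolding integral_mult_right[symmetric]
    by (intro Henstock_Kurzweil_Integration.integral_cong) (simp add: mult_ac)
  also have "\<dots> = L2_inner torus_measure \<phi> (torus_hartley k)"
    by (rule L2_inner_torus_lift[OF F(1) per lift, symmetric]) (assumption | rule torus_hartley_lift)+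
  finally show "L2_inner torus_measure (smooth_laplacian \<phi>) (torus_hartley k)
      = torus_eigenvalue k * L2_inner torus_measure \<phi> (torus_hartley k)" .
qed

text \<open>Testing the weak equation with a mode gives the relation of coefficients. Conversely,
  that relation implies the equation for every smooth test function: Parseval expands both inner
  products into the same series.\<close>

lemma diagonal_operator_laplace_beltrami:
  "diagonal_operator torus_measure UNIV (torus_hartley :: int ^ 'm::finite \<Rightarrow> _) laplace_beltrami torus_eigenvalue"
proof -
  interpret L2_basis torus_measure UNIV "torus_hartley :: int ^ 'm \<Rightarrow> _"
    by (rule L2_basis_torus_hartley)
  show ?thesis
  proof
    show "0 \<le> torus_eigenvalue k" for k :: "int ^ 'm" by (rule torus_eigenvalue_nonneg)
  next
    fix u g :: "complex ^ 'm \<Rightarrow> real" assume ug: "(u, g) \<in> laplace_beltrami"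
    then show "g \<in> L2_space torus_measure" by (simp add: laplace_beltrami_def)
    fix k :: "int ^ 'm"
    have "L2_inner torus_measure u (smooth_laplacian (torus_hartley k)) = L2_inner torus_measure g (torus_hartley k)"
      using ug smooth_torus_hartley[of k] unfolding laplace_beltrami_def by blast
    then show "L2_inner torus_measure g (torus_hartley k) = torus_eigenvalue k * L2_inner torus_measure u (torus_hartley k)"
      by (simp add: smooth_laplacian_torus_hartley L2_inner_scale_right)
  next
    fix u g :: "complex ^ 'm \<Rightarrow> real"
    assume u: "u \<in> L2_space torus_measure" and g: "g \<in> L2_space torus_measure"
      and eq: "\<And>k. k \<in> UNIV \<Longrightarrow> L2_inner torus_measure g (torus_hartley k)
        = torus_eigenvalue k * L2_inner torus_measure u (torus_hartley k)"
    have "L2_inner torus_measure u (smooth_laplacian \<phi>) = L2_inner torus_measure g \<phi>"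
      if \<phi>: "smooth_on_torus \<phi>" for \<phi>
    proof (rule has_sum_unique)
      show "((\<lambda>k. L2_inner torus_measure u (torus_hartley k) *
          L2_inner torus_measure (smooth_laplacian \<phi>) (torus_hartley k)) has_sum
          L2_inner torus_measure u (smooth_laplacian \<phi>)) UNIV"
        by (rule parseval[OF u L2_smooth_on_torus(2)[OF \<phi>]])
      have "((\<lambda>k. L2_inner torus_measure g (torus_hartley k) * L2_inner torus_measure \<phi> (torus_hartley k)) has_sum
          L2_inner torus_measure g \<phi>) UNIV"
        by (rule parseval[OF g L2_smooth_on_torus(1)[OF \<phi>]])
      then show "((\<lambda>k. L2_inner torus_measure u (torus_hartley k) *
          L2_inner torus_measure (smooth_laplacian \<phi>) (torus_hartley k)) has_sum
          L2_inner torus_measure g \<phi>) UNIV"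
        by (rule has_sum_cong[THEN iffD1, rotated]) (simp add: eq L2_smooth_on_torus(3)[OF \<phi>])
    qed
    then have "(u, g) \<in> laplace_beltrami" using u g by (simp add: laplace_beltrami_def)
    then show "\<exists>g'. (u, g') \<in> laplace_beltrami \<and> (AE x in torus_measure. g' x = g x)" by auto
  qed
qed

lemma has_L2_trace_torus_resolvent_power:
  assumes "z > 0"
  shows "has_L2_trace torus_measure (torus_resolvent_power z :: (complex ^ 'm::finite \<Rightarrow> real) \<Rightarrow> _)
    (\<Sum>\<^sub>\<infinity>k. 1 / (torus_eigenvalue (k :: int ^ 'm) + z\<^sup>2) ^ CARD('m))"
  unfolding torus_resolvent_power_def
  using assms by (intro diagonal_operator.has_L2_trace_resolvent_power[OF
    diagonal_operator_laplace_beltrami] has_sum_infsum torus_eigenvalue_summable) auto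

lemma torus_resolvent_trace_eq:
  assumes "z > 0"
  shows "torus_resolvent_trace TYPE('m::finite) z =
    (\<Sum>\<^sub>\<infinity>k. 1 / (torus_eigenvalue (k :: int ^ 'm) + z\<^sup>2) ^ CARD('m))"
  unfolding torus_resolvent_trace_def
  by (rule L2_basis.L2_trace_eqI[OF L2_basis_torus_hartley has_L2_trace_torus_resolvent_power[OF assms]])

section \<open>Convergence of the resolvent traces\<close>

text \<open>The j-th derivative in w of the sum of (ev i + w)^(-m): differentiation produces the
  factors -m, -(m + 1), ..., collected in the rising factorial.\<close>

definition trace_deriv :: "'i set \<Rightarrow> ('i \<Rightarrow> real) \<Rightarrow> nat \<Rightarrow> nat \<Rightarrow> real \<Rightarrow> real" where
  "trace_deriv I ev m j w = (- 1) ^ j * pochhammer (real m) j * inverse_power_sum I ev (m + j) w"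

lemma has_derivative_trace_deriv:
  assumes "\<And>i. i \<in> I \<Longrightarrow> 0 \<le> ev i"
    and "\<And>w. 0 < w \<Longrightarrow> (\<lambda>i. 1 / (ev i + w) ^ m) summable_on I" and "0 < w"
  shows "(trace_deriv I ev m j has_real_derivative trace_deriv I ev m (Suc j) w) (at w)"
proof -
  let ?c = "(- 1) ^ j * pochhammer (real m) j"
  have "(trace_deriv I ev m j has_real_derivative
      ?c * (- real (m + j) * inverse_power_sum I ev (Suc (m + j)) w)) (at w)"
    unfolding trace_deriv_def[abs_def]
    by (rule DERIV_cmult[OF has_derivative_inverse_power_sum[OF assms le_add1]])
  also have "?c * (- real (m + j) * inverse_power_sum I ev (Suc (m + j)) w) = trace_deriv I ev m (Suc j) w"
    by (simp add: trace_deriv_def pochhammer_Suc algebra_simps)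
  finally show ?thesis .
qed

lemma has_derivative_discrete_trace_deriv:
  assumes "0 < w"
  shows "(trace_deriv (discrete_torus n) (discrete_eigenvalue n :: int ^ 'm::finite \<Rightarrow> real) m j has_real_derivative
    trace_deriv (discrete_torus n) (discrete_eigenvalue n :: int ^ 'm \<Rightarrow> real) m (Suc j) w) (at w)"
  by (rule has_derivative_trace_deriv)
    (simp_all add: assms discrete_eigenvalue_nonneg finite_discrete_torus)

lemma has_derivative_torus_trace_deriv:
  assumes "0 < w"
  shows "(trace_deriv UNIV (torus_eigenvalue :: int ^ 'm::finite \<Rightarrow> real) CARD('m) j has_real_derivative
    trace_deriv UNIV (torus_eigenvalue :: int ^ 'm \<Rightarrow> real) CARD('m) (Suc j) w) (at w)"
  by (rule has_derivative_trace_deriv[OF torus_eigenvalue_nonneg torus_eigenvalue_summable assms])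

lemma discrete_resolvent_trace_eq_trace_deriv:
  "n \<ge> 1 \<Longrightarrow> 0 < z \<Longrightarrow> discrete_resolvent_trace TYPE('m::finite) n z =
    trace_deriv (discrete_torus n) (discrete_eigenvalue n :: int ^ 'm \<Rightarrow> real) CARD('m) 0 (z\<^sup>2)"
  by (simp add: discrete_resolvent_trace_eq trace_deriv_def inverse_power_sum_def finite_discrete_torus)

lemma torus_resolvent_trace_eq_trace_deriv:
  "0 < z \<Longrightarrow> torus_resolvent_trace TYPE('m::finite) z =
    trace_deriv UNIV (torus_eigenvalue :: int ^ 'm \<Rightarrow> real) CARD('m) 0 (z\<^sup>2)"
  by (simp add: torus_resolvent_trace_eq trace_deriv_def inverse_power_sum_def)

text \<open>\<open>L2_trace\<close> is a definite description, so the existence clauses ensure that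
  the traces being differentiated are genuine. For n = 0 the discrete torus is empty, whence the
  restriction to n at least 1.\<close>

theorem proposition1p4:
  shows
    "(\<forall>n\<ge>1. \<forall>z>0. \<exists>t. has_L2_trace (count_space (discrete_torus n))
        (discrete_resolvent_power n z :: (int ^ 'm::finite \<Rightarrow> real) \<Rightarrow> _) t) \<and>
     (\<forall>z>0. \<exists>t. has_L2_trace torus_measure
        (torus_resolvent_power z :: (complex ^ 'm \<Rightarrow> real) \<Rightarrow> _) t) \<and>
     (\<forall>n\<ge>1. smooth_on_open {0<..} (discrete_resolvent_trace TYPE('m) n)) \<and>
     smooth_on_open {0<..} (torus_resolvent_trace TYPE('m)) \<and>
     (\<forall>k. \<forall>z>0.
        (\<lambda>n. (deriv ^^ k) (discrete_resolvent_trace TYPE('m) n) z)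
          \<longlonglongrightarrow> (deriv ^^ k) (torus_resolvent_trace TYPE('m)) z)"
proof (intro conjI allI impI)
  fix n :: nat assume n: "1 \<le> n"
  show "\<exists>t. has_L2_trace (count_space (discrete_torus n))
      (discrete_resolvent_power n z :: (int ^ 'm \<Rightarrow> real) \<Rightarrow> _) t" if "0 < z" for z
    using has_L2_trace_discrete_resolvent_power[OF n that] by blast
  show "smooth_on_open {0<..} (discrete_resolvent_trace TYPE('m) n)"
    using has_derivative_discrete_trace_deriv discrete_resolvent_trace_eq_trace_deriv[OF n]
    by (rule smooth_on_open_square_comp)
next
  show "\<exists>t. has_L2_trace torus_measure (torus_resolvent_power z :: (complex ^ 'm \<Rightarrow> real) \<Rightarrow> _) t"
    if "0 < z" for z
    using has_L2_trace_torus_resolvent_power[OF that] by blast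
  show "smooth_on_open {0<..} (torus_resolvent_trace TYPE('m))"
    using has_derivative_torus_trace_deriv torus_resolvent_trace_eq_trace_deriv
    by (rule smooth_on_open_square_comp)
next
  fix k and z :: real assume z: "0 < z"
  let ?d = "\<lambda>n. trace_deriv (discrete_torus n) (discrete_eigenvalue n :: int ^ 'm \<Rightarrow> real) CARD('m)"
  let ?t = "trace_deriv UNIV (torus_eigenvalue :: int ^ 'm \<Rightarrow> real) CARD('m)"
  \<comment> \<open>Neither the polynomials nor the factors in \<open>trace_deriv\<close> depend on
    n; only the inverse power sums, with exponents CARD('m) + j, have to converge.\<close>
  have "(\<lambda>n. \<Sum>j\<le>k. poly (square_chain_coeff k j) z * ?d n j (z\<^sup>2))
      \<longlonglongrightarrow> (\<Sum>j\<le>k. poly (square_chain_coeff k j) z * ?t j (z\<^sup>2))"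
    unfolding trace_deriv_def
    using z by (intro tendsto_intros inverse_power_sum_tendsto) auto
  also have "(\<Sum>j\<le>k. poly (square_chain_coeff k j) z * ?t j (z\<^sup>2)) = (deriv ^^ k) (torus_resolvent_trace TYPE('m)) z"
    using higher_deriv_square_comp[OF has_derivative_torus_trace_deriv
      torus_resolvent_trace_eq_trace_deriv[where 'm = 'm] z] by simp
  finally show "(\<lambda>n. (deriv ^^ k) (discrete_resolvent_trace TYPE('m) n) z)
      \<longlonglongrightarrow> (deriv ^^ k) (torus_resolvent_trace TYPE('m)) z"
  proof (rule Lim_transform_eventually)
    show "\<forall>\<^sub>F n in sequentially. (\<Sum>j\<le>k. poly (square_chain_coeff k j) z * ?d n j (z\<^sup>2))
        = (deriv ^^ k) (discrete_resolvent_trace TYPE('m) n) z"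
      using eventually_ge_at_top[of 1]
    proof eventually_elim
      case (elim n)
      show ?case
        using higher_deriv_square_comp[OF has_derivative_discrete_trace_deriv
          discrete_resolvent_trace_eq_trace_deriv[OF elim, where 'm = 'm] z] by simp
    qed
  qed
qed

end
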